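(* Let $n\in\mathbb N$ with $n\ge 2$, and let $\ell(n)\in\mathbb N$ satisfy $2^{\ell(n)}\le n<2^{\ell(n)+1}$. Then for every $I\subset\alpha(\ell(n))$ with $\operatorname{card}(I)=n-2^{\ell(n)}$, the set $\alpha_n(I)$ is an optimal set of $n$-means for $P$, and the $n$th quantization error is $$V_n=\frac{1}{18^{\ell(n)}}\cdot\frac18\Big(2^{\ell(n)+1}-n+\frac19\big(n-2^{\ell(n)}\big)\Big).$$ The number of such sets $\alpha_n(I)$ (as $I$ varies) is the binomial coefficient $\binom{2^{\ell(n)}}{n-2^{\ell(n)}}$.
   Context: $\mathbb N=\{1,2,\dots\}$. For $j\in\mathbb N$ let $S_j(x)=\frac1{3^j}x+1-\frac1{3^{j-1}}$ ($x\in\mathbb R$), $s_j=3^{-j}$, $p_j=2^{-j}$. $P$ is the unique Borel probability measure on $\mathbb R$ with $P=\sum_{j=1}^\infty\frac1{2^j}P\circ S_j^{-1}$. $\mathbb N^*$ is the set of finite words over $\mathbb N$ including the empty word. For $\omega=\omega_1\cdots\omega_k\in\mathbb N^*$: $|\omega|=k$, $S_\omega=S_{\omega_1}\circ\cdots\circ S_{\omega_k}$, $s_\omega=s_{\omega_1}\cdots s_{\omega_k}$, $p_\omega=p_{\omega_1}\cdots p_{\omega_k}$ (identity map, $1$, $1$ for the empty word), $J_\omega=S_\omega([0,1])$. For nonempty $\omega$, $\omega^-=\omega_1\cdots\omega_{k-1}$, and $\omega^-(\omega_{|\omega|}+j)$ denotes the word $\omega$ with its last letter increased by $j$. Put $J_{(\omega,\infty)}=\bigcup_{j\ge1}J_{\omega^-(\omega_{|\omega|}+j)}$.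 Let $X$ be a random variable with distribution $P$. Then $a(\omega)=E(X\mid X\in J_\omega)=S_\omega(\frac12)$ and, for nonempty $\omega$, $a(\omega,\infty)=E(X\mid X\in J_{(\omega,\infty)})=S_{\omega^-(\omega_{|\omega|}+1)}(\frac12)+s_{\omega^-(\omega_{|\omega|}+1)}$. The pair notation extends to words: $a(\omega1,\infty)$ is $a(\tau,\infty)$ with $\tau=\omega1$, and $a(\omega^-(\omega_{|\omega|}+1),\infty)$ is $a(\tau,\infty)$ with $\tau=\omega^-(\omega_{|\omega|}+1)$. For $\ell\in\mathbb N$, $\alpha(\ell)=\{a(\omega):\omega\in\mathbb N^*,\ p_\omega=2^{-\ell}\}\cup\{a(\omega,\infty):\omega\in\mathbb N^*,\ p_\omega=2^{-\ell}\}$. For $n\ge2$ and $I\subset\alpha(\ell(n))$ with $\operatorname{card}(I)=n-2^{\ell(n)}$, $$\alpha_n(I)=(\alpha(\ell(n))\setminus I)\cup\{a(\omega1):a(\omega)\in I\}\cup\{a(\omega1,\infty):a(\omega)\in I\}\cup\{a(\omega^-(\omega_{|\omega|}+1)):a(\omega,\infty)\in I\}\cup\{a(\omega^-(\omega_{|\omega|}+1),\infty):a(\omega,\infty)\in I\}.$$ The $n$th quantization error is $V_n=\inf\{\int\min_{a\in\alpha}(x-a)^2\,dP(x):\alpha\subset\mathbb R,\ 1\le\operatorname{card}(\alpha)\le n\}$; a set $\alpha$ with at most $n$ points attaining the infimum is called an optimal set of $n$-means for $P$. *)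

theory Defs
  imports "HOL-Probability.Probability"
begin

text \<open>Letters are the positive integers; \<open>sim j\<close> is only meant for \<open>j \<ge> 1\<close>.\<close>

definition sim :: "nat \<Rightarrow> real \<Rightarrow> real" where
  "sim j x = 1 / 3 ^ j * x + 1 - 1 / 3 ^ (j - 1)"

definition self_similar_measure :: "real measure \<Rightarrow> bool" where
  "self_similar_measure P \<longleftrightarrow> prob_space P \<and> sets P = sets borel \<and>
     (\<forall>A \<in> sets borel.
        ((\<lambda>j. 1 / 2 ^ j * measure (distr P borel (sim j)) A) has_sum measure P A) {1::nat..})"

definition words :: "nat list set" where
  "words = lists {1..}"

definition sim_word :: "nat list \<Rightarrow> real \<Rightarrow> real" where
  "sim_word w = foldr sim w"

definition prob_word :: "nat list \<Rightarrow> real" where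
  "prob_word w = (\<Prod>j\<leftarrow>w. 1 / 2 ^ j)"

definition cell :: "nat list \<Rightarrow> real set" where
  "cell w = sim_word w ` {0..1}"

text \<open>\<open>bump w j\<close> increases the last letter of the nonempty word \<open>w\<close> by \<open>j\<close>.\<close>

definition bump :: "nat list \<Rightarrow> nat \<Rightarrow> nat list" where
  "bump w j = butlast w @ [last w + j]"

definition cell_inf :: "nat list \<Rightarrow> real set" where
  "cell_inf w = (\<Union>j\<in>{1..}. cell (bump w j))"

text \<open>The conditional expectation \<open>E(X | X \<in> A)\<close> for \<open>X\<close> with distribution \<open>P\<close>.\<close>

definition cond_mean :: "real measure \<Rightarrow> real set \<Rightarrow> real" where
  "cond_mean P A = (LINT x:A|P. x) / measure P A"

definition center :: "real measure \<Rightarrow> nat list \<Rightarrow> real" where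
  "center P w = cond_mean P (cell w)"

definition center_inf :: "real measure \<Rightarrow> nat list \<Rightarrow> real" where
  "center_inf P w = cond_mean P (cell_inf w)"

definition alpha :: "real measure \<Rightarrow> nat \<Rightarrow> real set" where
  "alpha P l =
     {center P w | w. w \<in> words \<and> prob_word w = 1 / 2 ^ l} \<union>
     {center_inf P w | w. w \<in> words \<and> w \<noteq> [] \<and> prob_word w = 1 / 2 ^ l}"

definition alpha_n :: "real measure \<Rightarrow> nat \<Rightarrow> real set \<Rightarrow> real set" where
  "alpha_n P l I = (alpha P l - I) \<union>
     {center P (w @ [1]) | w. w \<in> words \<and> center P w \<in> I} \<union>
     {center_inf P (w @ [1]) | w. w \<in> words \<and> center P w \<in> I} \<union>
     {center P (bump w 1) | w. w \<in> words \<and> w \<noteq> [] \<and> center_inf P w \<in> I} \<union>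
     {center_inf P (bump w 1) | w. w \<in> words \<and> w \<noteq> [] \<and> center_inf P w \<in> I}"

definition distortion :: "real measure \<Rightarrow> real set \<Rightarrow> real" where
  "distortion P A = (LINT x|P. (MIN c\<in>A. (x - c)\<^sup>2))"

text \<open>\<open>1 \<le> card A\<close> forces \<open>A\<close> to be finite and nonempty.\<close>

definition quantization_error :: "real measure \<Rightarrow> nat \<Rightarrow> real" where
  "quantization_error P n = Inf {distortion P A | A. 1 \<le> card A \<and> card A \<le> n}"

definition optimal_means :: "real measure \<Rightarrow> nat \<Rightarrow> real set \<Rightarrow> bool" where
  "optimal_means P n A \<longleftrightarrow>
     1 \<le> card A \<and> card A \<le> n \<and> distortion P A = quantization_error P n"


text \<open>Existence of the self-similar measure: the law of the limit point
  coded by a sequence of independent geometrically distributed letters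
  (the letter in position \<open>i\<close> being \<open>s !! i + 1\<close>).\<close>

definition code_term :: "nat stream \<Rightarrow> nat \<Rightarrow> real" where
  "code_term s k = (\<Prod>i<k. 1 / 3 ^ (s !! i + 1)) * (1 - 1 / 3 ^ (s !! k))"

definition code_point :: "nat stream \<Rightarrow> real" where
  "code_point s = (\<Sum>k. code_term s k)"

lemma summable_code_term: "summable (code_term s)"
proof (rule summable_comparison_test')
  show "summable (\<lambda>k. (1/3::real) ^ k)" by (rule summable_geometric) simp
  fix k :: nat
  have "(\<Prod>i<k. 1 / (3::real) ^ (s !! i + 1)) \<le> (\<Prod>i<k. 1/3)"
    by (rule prod_mono) (auto simp: field_simps)
  moreover have "0 \<le> (\<Prod>i<k. 1 / (3::real) ^ (s !! i + 1))"
    by (rule prod_nonneg) auto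
  moreover have "0 \<le> 1 - 1 / (3::real) ^ (s !! k)" "1 - 1 / (3::real) ^ (s !! k) \<le> 1"
    by (auto simp: field_simps)
  ultimately show "norm (code_term s k) \<le> (1/3) ^ k"
    unfolding code_term_def by (auto simp: abs_mult intro: mult_le_one order_trans[OF mult_right_le_one_le])
qed

lemma code_point_Stream: "code_point (t ## s) = sim (Suc t) (code_point s)"
proof -
  have 1: "code_term (t ## s) (Suc k) = 1 / 3 ^ Suc t * code_term s k" for k
    unfolding code_term_def prod.lessThan_Suc_shift by simp
  have "code_point (t ## s) = code_term (t ## s) 0 + (\<Sum>k. code_term (t ## s) (Suc k))"
    unfolding code_point_def using suminf_split_head[OF summable_code_term] by simp
  also have "(\<Sum>k. code_term (t ## s) (Suc k)) = 1 / 3 ^ Suc t * code_point s"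
    unfolding 1 code_point_def by (rule suminf_mult[OF summable_code_term])
  finally show ?thesis by (simp add: sim_def code_term_def)
qed

lemma measurable_sim [measurable]: "sim j \<in> borel_measurable borel"
  unfolding sim_def by measurable

lemma self_similar_measure_exists: "\<exists>P. self_similar_measure P"
proof -
  define G where "G = measure_pmf (geometric_pmf (1/2))"
  interpret G: prob_space G unfolding G_def by (rule measure_pmf.prob_space_axioms)
  have sG [measurable_cong]: "sets G = sets (count_space UNIV)" by (simp add: G_def)
  interpret SG: prob_space "stream_space G" by (rule G.prob_space_stream_space)
  have [measurable]: "code_point \<in> borel_measurable (stream_space G)"
    unfolding code_point_def code_term_def by measurable
  define P where "P = distr (stream_space G) borel code_point"
  interpret P: prob_space P unfolding P_def by (rule SG.prob_space_distr) measurable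
  have space_SG: "space (stream_space G) = UNIV"
    by (simp add: space_stream_space G_def)
  have "((\<lambda>j. 1 / 2 ^ j * measure (distr P borel (sim j)) A) has_sum measure P A) {1::nat..}"
    if [measurable]: "A \<in> sets borel" for A
  proof -
    let ?B = "code_point -` A \<inter> space (stream_space G)"
    let ?f = "\<lambda>j. measure (distr P borel (sim j)) A"
    have B [measurable]: "?B \<in> sets (stream_space G)" by measurable
    have "emeasure P A = emeasure (stream_space G) ?B"
      unfolding P_def by (rule emeasure_distr) measurable
    also have "\<dots> = (\<integral>\<^sup>+t. emeasure (stream_space G) {x \<in> space (stream_space G). t ## x \<in> ?B} \<partial>G)"
      by (rule G.emeasure_stream_space[OF B])
    also have "\<dots> = (\<integral>\<^sup>+t. ennreal (?f (Suc t)) \<partial>G)"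
    proof (rule nn_integral_cong)
      fix t
      interpret DPt: prob_space "distr P borel (sim (Suc t))"
        by (rule P.prob_space_distr) (simp add: P_def)
      have "emeasure (distr P borel (sim (Suc t))) A
          = emeasure (stream_space G) (code_point -` (sim (Suc t) -` A) \<inter> space (stream_space G))"
        unfolding P_def by (simp add: emeasure_distr distr_distr comp_def vimage_def)
      also have "code_point -` (sim (Suc t) -` A) \<inter> space (stream_space G)
          = {x \<in> space (stream_space G). t ## x \<in> ?B}"
        by (auto simp: space_SG code_point_Stream)
      finally show "emeasure (stream_space G) {x \<in> space (stream_space G). t ## x \<in> ?B}
          = ennreal (?f (Suc t))"
        by (metis DPt.emeasure_eq_measure)
    qed
    also have "\<dots> = (\<Sum>t. ennreal (1 / 2 ^ Suc t * ?f (Suc t)))"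
      unfolding G_def nn_integral_measure_pmf nn_integral_count_space_nat
      by (simp add: ennreal_mult'[symmetric] power_one_over mult.commute)
    finally have eq: "ennreal (measure P A) = (\<Sum>t. ennreal (1 / 2 ^ Suc t * ?f (Suc t)))"
      by (simp add: P.emeasure_eq_measure)
    have "(\<lambda>t. ennreal (1 / 2 ^ Suc t * ?f (Suc t))) sums ennreal (measure P A)"
      unfolding eq by (rule summable_sums) simp
    hence "(\<lambda>t. 1 / 2 ^ Suc t * ?f (Suc t)) sums measure P A"
      by (subst (asm) sums_ennreal) auto
    hence "((\<lambda>t. 1 / 2 ^ Suc t * ?f (Suc t)) has_sum measure P A) UNIV"
      by (rule sums_nonneg_imp_has_sum) auto
    hence "((\<lambda>j. 1 / 2 ^ j * ?f j) has_sum measure P A) (Suc ` UNIV)"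
      by (subst has_sum_reindex) (auto simp: comp_def)
    moreover have "Suc ` UNIV = {1..}" by (auto simp: image_iff Suc_le_eq gr0_conv_Suc)
    ultimately show ?thesis by simp
  qed
  hence "self_similar_measure P"
    unfolding self_similar_measure_def by (simp add: P.prob_space_axioms) (simp add: P_def)
  thus ?thesis ..
qed

end

theory Submission
  imports Defs
begin

text \<open>
  Put \<open>T\<^sub>0 x = x / 3\<close> and \<open>T\<^sub>1 x = (x + 2) / 3\<close>.  Since \<open>sim j\<close> is \<open>T\<^sub>1\<close> iterated \<open>j - 1\<close> times
  after \<open>T\<^sub>0\<close>, splitting off the letter 1 in the defining series shows that \<open>P\<close> is the average
  of its images under \<open>T\<^sub>0\<close> and \<open>T\<^sub>1\<close>: it is the Cantor distribution
  (\<open>self_similar_imp_cantor_law\<close>).  In the binary coding a letter \<open>j\<close> is the block of \<open>j - 1\<close>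
  ones followed by a zero.  A word of probability \<open>1 / 2 ^ l\<close> becomes a binary word of length
  \<open>l\<close> ending in 0, and the union of its younger siblings becomes, up to a null set, the Cantor
  cell of the word with that last 0 turned into 1.  Hence \<open>alpha P l\<close> consists of the
  midpoints of all \<open>2 ^ l\<close> Cantor cells of level \<open>l\<close>, and \<open>alpha_n P l I\<close> replaces each midpoint
  in \<open>I\<close> by those of the two subcells (\<open>alpha_eq\<close>, \<open>alpha_n_eq\<close>).  Assigning to each cell its
  own midpoint bounds the distortion of \<open>alpha_n P l I\<close> from above by the claimed value
  (\<open>distortion_refine_le\<close>), because a cell of level \<open>k\<close> contributes \<open>1 / (8 * 18 ^ k)\<close>.  The set
  \<open>I\<close> can be read off as the part of \<open>alpha P l\<close> that is missing from \<open>alpha_n P l I\<close>, which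
  gives the count.

  The content is the matching lower bound for an arbitrary set \<open>A\<close>.  As a function of \<open>n\<close>, the
  claimed \<open>V\<^sub>n\<close> is convex and piecewise linear with nodes at the powers of 2, so it is the
  supremum of its affine pieces, \<open>chord l\<close> for \<open>l \<ge> 1\<close> being the piece between \<open>2 ^ (l - 1)\<close>
  and \<open>2 ^ l\<close>.
  It therefore suffices to prove that the distortion of \<open>A\<close> is at least \<open>chord l (card A)\<close> for
  \<^emph>\<open>every\<close> \<open>l\<close> (\<open>chord_le_distortion\<close>).  This goes by induction on \<open>l\<close>: the distortion of \<open>A\<close>
  is a fixed multiple of the sum of the distortions of \<open>A\<close> seen from the two thirds
  (\<open>distortion_halves\<close>), and the chords satisfy exactly the same recursion
  (\<open>chord_Suc\<close>).  Thus all is well if the points left of the gap \<open>(1/3, 2/3)\<close> serve only the left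
  third and those right of it only the right third.  Points in the gap are the only obstacle.
  Two of them may be moved to the two ends of the gap.  A single one lies at least \<open>1/6\<close> away from
  one of the two thirds, by symmetry the right one, and is too far from it to be worth a point there:
  either it serves nothing on the right, or the points on the right are so badly placed that
  their cost alone exceeds the bound.  The exception to the latter are three points, one in each of
  the two thirds and one in the gap, for which the costs of both thirds have to be estimated
  explicitly (\<open>distortion_with_one\<close>,
  \<open>distortion_minus_half_pair\<close>).
\<close>

section \<open>The measure as Cantor distribution\<close>

definition third :: "bool \<Rightarrow> real \<Rightarrow> real" where
  "third b x = (x + (if b then 2 else 0)) / 3"

lemma third_measurable [measurable]: "third b \<in> borel_measurable borel"
  unfolding third_def by measurable

lemma third_mem: "x \<in> {0..1} \<Longrightarrow> third b x \<in> {0..1}"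
  by (auto simp: third_def)

lemma third_dist_half: "\<bar>third b x - 1/2\<bar> \<le> \<bar>x - 1/2\<bar> / 3 + 1/3"
  by (auto simp: third_def abs_if field_simps)

locale cantor_law = prob_space P for P :: "real measure" +
  assumes sets_P [measurable_cong]: "sets P = sets borel"
    and halves: "A \<in> sets borel \<Longrightarrow>
      measure P A = (measure P (third False -` A) + measure P (third True -` A)) / 2"

text \<open>
  Because \<open>sim (Suc j) = third True \<circ> sim j\<close>, the tail of the series after its first term is the
  series itself, halved and transported by \<open>third True\<close>.
\<close>

lemma self_similar_imp_cantor_law:
  assumes "self_similar_measure P"
  shows "cantor_law P"
proof -
  interpret prob_space P using assms by (simp add: self_similar_measure_def)
  have sets_P [measurable_cong]: "sets P = sets borel"
    using assms by (simp add: self_similar_measure_def)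
  have space_P: "space P = UNIV" using sets_eq_imp_space_eq[OF sets_P] by simp
  show ?thesis
  proof
    show "sets P = sets borel" by fact
    fix A :: "real set" assume A [measurable]: "A \<in> sets borel"
    let ?f = "\<lambda>A j. 1 / 2 ^ j * measure (distr P borel (sim j)) A"
    have sum: "(?f B has_sum measure P B) {1::nat..}" if "B \<in> sets borel" for B
      using assms that by (auto simp: self_similar_measure_def)
    let ?B = "third True -` A"
    have [measurable]: "?B \<in> sets borel"
      using measurable_sets[OF third_measurable A, of True] by simp
    have md: "measure (distr P borel (sim j)) C = measure P (sim j -` C)"
      if "C \<in> sets borel" for C j
      using that by (simp add: measure_distr space_P)
    \<comment> \<open>The restriction \<open>j \<ge> 1\<close> matters: \<open>sim 0\<close> involves the truncated exponent \<open>0 - 1 = 0\<close>.\<close>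
    have shift: "?f A (Suc j) = 1 / 2 * ?f ?B j" if "j \<in> {1..}" for j
    proof -
      have "third True (sim j x) = sim (Suc j) x" for x
        using that by (cases j) (auto simp: third_def sim_def field_simps)
      hence "sim (Suc j) -` A = sim j -` ?B" by (auto simp: vimage_def)
      thus ?thesis by (simp add: md)
    qed
    have "((\<lambda>j. 1 / 2 * ?f ?B j) has_sum 1 / 2 * measure P ?B) {1..}"
      by (rule has_sum_cmult_right) (rule sum, measurable)
    hence "((?f A \<circ> Suc) has_sum 1 / 2 * measure P ?B) {1..}"
      by (rule has_sum_cong[THEN iffD1, rotated]) (use shift in auto)
    hence tail: "(?f A has_sum 1 / 2 * measure P ?B) (Suc ` {1..})"
      by (subst has_sum_reindex) auto
    have "(?f A has_sum ?f A 1) {1}" by (rule has_sum_finiteI) auto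
    from has_sum_Un_disjoint[OF this tail]
    have "(?f A has_sum (?f A 1 + 1 / 2 * measure P ?B)) ({1} \<union> Suc ` {1..})" by auto
    moreover have "{1} \<union> Suc ` {1..} = {1::nat..}"
    proof (intro equalityI subsetI)
      fix j :: nat assume "j \<in> {1..}"
      thus "j \<in> {1} \<union> Suc ` {1..}" by (cases "j = 1"; cases j) auto
    qed auto
    ultimately have "measure P A = ?f A 1 + 1 / 2 * measure P ?B"
      using has_sum_unique[OF sum[OF A]] by simp
    moreover have "sim 1 = third False" by (auto simp: sim_def third_def)
    ultimately show "measure P A = (measure P (third False -` A) + measure P ?B) / 2"
      by (simp add: md)
  qed
qed

context cantor_law
begin

lemma space_P [simp]: "space P = UNIV"
  using sets_eq_imp_space_eq[OF sets_P] by simp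

text \<open>
  Both maps contract towards \<open>[0, 1]\<close> by the factor 3.  Iterating this inequality pushes
  the mass outside any neighbourhood of \<open>[0, 1]\<close> out to infinity, so that there is none.
\<close>

lemma measure_outside_le:
  "measure P {x. M < \<bar>x - 1/2\<bar>} \<le> measure P {x. 3 * M - 1 < \<bar>x - 1/2\<bar>}"
proof -
  have *: "measure P (third b -` {x. M < \<bar>x - 1/2\<bar>}) \<le> measure P {x. 3 * M - 1 < \<bar>x - 1/2\<bar>}" for b
  proof (rule finite_measure_mono)
    show "third b -` {x. M < \<bar>x - 1/2\<bar>} \<subseteq> {x. 3 * M - 1 < \<bar>x - 1/2\<bar>}"
    proof clarsimp
      fix x assume "M < \<bar>third b x - 1/2\<bar>"
      thus "3 * M - 1 < \<bar>x - 1/2\<bar>" using third_dist_half[of b x] by argo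
    qed
  qed (simp add: sets_P)
  show ?thesis using *[of True] *[of False] by (subst halves) auto
qed

lemma AE_unit: "AE x in P. x \<in> {0..1}"
proof -
  have "AE x in P. \<bar>x - 1/2\<bar> \<le> 1/2 + 1 / Suc m" for m
  proof -
    define e :: real where "e = 1 / Suc m"
    have e: "e > 0" by (simp add: e_def)
    let ?A = "\<lambda>k. {x. 1/2 + 3 ^ k * e < \<bar>x - 1/2\<bar>}"
    have le: "measure P (?A 0) \<le> measure P (?A k)" for k
    proof (induction k)
      case (Suc k)
      also have "measure P (?A k) \<le> measure P {x. 3 * (1/2 + 3 ^ k * e) - 1 < \<bar>x - 1/2\<bar>}"
        by (rule measure_outside_le)
      also have "3 * (1/2 + 3 ^ k * e) - 1 = 1/2 + 3 ^ Suc k * e" by (simp add: field_simps)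
      finally show ?case .
    qed simp
    have "decseq ?A"
    proof (rule decseq_SucI, clarsimp)
      fix k x assume "1/2 + 3 * 3 ^ k * e < \<bar>x - 1/2\<bar>"
      moreover have "3 ^ k * e \<ge> 0" using e by simp
      ultimately show "1/2 + 3 ^ k * e < \<bar>x - 1/2\<bar>" by linarith
    qed
    hence "(\<lambda>k. measure P (?A k)) \<longlonglongrightarrow> measure P (\<Inter>k. ?A k)"
      by (intro finite_Lim_measure_decseq) (auto simp: sets_P)
    moreover have "(\<Inter>k. ?A k) = {}"
    proof safe
      fix x assume x: "x \<in> (\<Inter>k. ?A k)"
      obtain k where "\<bar>x - 1/2\<bar> / e < 3 ^ k" using real_arch_pow[of 3 "\<bar>x - 1/2\<bar> / e"] by auto
      hence "\<bar>x - 1/2\<bar> < 3 ^ k * e" using e by (simp add: field_simps)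
      moreover have "1/2 + 3 ^ k * e < \<bar>x - 1/2\<bar>" using x by blast
      ultimately show "x \<in> {}" by linarith
    qed
    ultimately have "(\<lambda>k. measure P (?A k)) \<longlonglongrightarrow> 0" by simp
    hence "measure P (?A 0) \<le> 0" by (rule LIMSEQ_le_const) (use le in auto)
    hence "measure P (?A 0) = 0" using measure_nonneg[of P "?A 0"] by linarith
    hence "?A 0 \<in> null_sets P" by (auto simp: null_sets_def emeasure_eq_measure sets_P)
    thus ?thesis by (rule AE_I'[where N = "?A 0"]) (auto simp: e_def)
  qed
  hence "AE x in P. \<forall>m. \<bar>x - 1/2\<bar> \<le> 1/2 + 1 / Suc m" by (simp add: AE_all_countable)
  thus ?thesis
  proof eventually_elim
    case (elim x)
    have "\<bar>x - 1/2\<bar> \<le> 1/2"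
    proof (rule field_le_epsilon)
      fix e :: real assume "e > 0"
      then obtain m where "inverse (Suc m) < e" using reals_Archimedean by blast
      with elim[rule_format, of m] show "\<bar>x - 1/2\<bar> \<le> 1/2 + e" by (simp add: inverse_eq_divide)
    qed
    thus ?case by (auto simp: abs_if split: if_splits)
  qed
qed

lemma integrable_continuous:
  fixes f :: "real \<Rightarrow> real"
  assumes "continuous_on UNIV f"
  shows "integrable P f"
proof -
  have "compact (f ` {0..1})"
    by (rule compact_continuous_image) (auto intro: continuous_on_subset[OF assms])
  then obtain B where B: "\<And>x. x \<in> {0..1} \<Longrightarrow> norm (f x) \<le> B"
    using compact_imp_bounded by (force simp: bounded_iff)
  show ?thesis
  proof (rule integrable_const_bound[where B = B])
    show "AE x in P. norm (f x) \<le> B" using AE_unit by eventually_elim (use B in auto)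
    show "f \<in> borel_measurable P"
      using borel_measurable_continuous_onI[OF assms] measurable_cong_sets[OF sets_P refl] by blast
  qed
qed

text \<open>
  Writing the law as the image of a fair coin times itself makes Fubini's theorem yield the
  self-similarity of integrals.
\<close>

lemma distr_coin:
  "P = distr (measure_pmf (bernoulli_pmf (1/2)) \<Otimes>\<^sub>M P) borel (\<lambda>(b, x). third b x)"
  (is "P = distr (?B \<Otimes>\<^sub>M P) borel ?T")
proof (rule measure_eqI)
  have [measurable]: "?T \<in> borel_measurable (?B \<Otimes>\<^sub>M P)"
    unfolding third_def by measurable
  show "sets P = sets (distr (?B \<Otimes>\<^sub>M P) borel ?T)" by (simp add: sets_P)
  fix A assume "A \<in> sets P"
  hence A [measurable]: "A \<in> sets borel" by (simp add: sets_P)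
  let ?f = "measure P (third False -` A)" and ?t = "measure P (third True -` A)"
  let ?C = "?T -` A \<inter> space (?B \<Otimes>\<^sub>M P)"
  have "emeasure (distr (?B \<Otimes>\<^sub>M P) borel ?T) A = emeasure (?B \<Otimes>\<^sub>M P) ?C"
    by (rule emeasure_distr) auto
  also have "\<dots> = (\<integral>\<^sup>+b. emeasure P (Pair b -` ?C) \<partial>?B)"
    by (rule emeasure_pair_measure_alt) measurable
  also have "\<dots> = (\<integral>\<^sup>+b. ennreal (measure P (third b -` A)) \<partial>?B)"
    by (intro nn_integral_cong) (auto simp: emeasure_eq_measure space_pair_measure vimage_def)
  also have "\<dots> = ennreal ?t * ennreal (1/2) + ennreal ?f * ennreal (1 - 1/2)"
    by (rule nn_integral_bernoulli_pmf) auto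
  also have "\<dots> = ennreal (?t * (1/2)) + ennreal (?f * (1 - 1/2))"
    using ennreal_mult''[of "1/2" ?t] ennreal_mult''[of "1 - 1/2" ?f] by argo
  also have "\<dots> = ennreal (?t * (1/2) + ?f * (1 - 1/2))"
    by (rule ennreal_plus[symmetric]) auto
  also have "?t * (1/2) + ?f * (1 - 1/2) = (?f + ?t) / 2" by argo
  also have "\<dots> = emeasure P A"
    using halves[OF A] by (simp add: emeasure_eq_measure)
  finally show "emeasure P A = emeasure (distr (?B \<Otimes>\<^sub>M P) borel ?T) A" by simp
qed

lemma integral_halves:
  fixes f :: "real \<Rightarrow> real"
  assumes f: "integrable P f"
  shows "(LINT x|P. f x) = ((LINT x|P. f (third False x)) + (LINT x|P. f (third True x))) / 2"
proof -
  let ?B = "measure_pmf (bernoulli_pmf (1/2))"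
  let ?T = "\<lambda>(b, x). third b x"
  interpret B: prob_space ?B by (rule measure_pmf.prob_space_axioms)
  interpret BP: pair_sigma_finite ?B P ..
  have [measurable]: "?T \<in> borel_measurable (?B \<Otimes>\<^sub>M P)"
    unfolding third_def by measurable
  have [measurable]: "f \<in> borel_measurable borel"
    using borel_measurable_integrable[OF f] measurable_cong_sets[OF sets_P refl] by blast
  let ?D = "distr (?B \<Otimes>\<^sub>M P) borel ?T"
  have "integrable ?D f" using f distr_coin by metis
  hence int: "integrable (?B \<Otimes>\<^sub>M P) (\<lambda>z. f (?T z))"
    by (rule integrable_distr[rotated]) measurable
  have "(LINT x|P. f x) = (LINT x|?D. f x)" using distr_coin by metis
  also have "\<dots> = (LINT z|(?B \<Otimes>\<^sub>M P). f (?T z))"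
    by (rule integral_distr) measurable
  finally have "(LINT x|P. f x) = (LINT z|(?B \<Otimes>\<^sub>M P). f (?T z))" .
  also have "\<dots> = (LINT b|?B. LINT x|P. f (third b x))"
    using BP.integral_fst'[OF int] by (simp add: case_prod_unfold)
  also have "\<dots> = ((LINT x|P. f (third False x)) + (LINT x|P. f (third True x))) / 2"
    by (simp add: integral_bernoulli_pmf add_divide_distrib)
  finally show ?thesis .
qed

lemma integral_continuous_mono:
  fixes f g :: "real \<Rightarrow> real"
  assumes "continuous_on UNIV f" "continuous_on UNIV g"
    and "\<And>x. x \<in> {0..1} \<Longrightarrow> f x \<le> g x"
  shows "(LINT x|P. f x) \<le> (LINT x|P. g x)"
  by (rule integral_mono_AE[OF integrable_continuous[OF assms(1)] integrable_continuous[OF assms(2)]])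
     (use AE_unit in eventually_elim, use assms(3) in auto)

text \<open>
  Self-similarity determines the mean \<open>1/2\<close> and the second moment \<open>3/8\<close> from linear equations.
\<close>

lemma integral_quadratic:
  "(LINT x|P. a * x\<^sup>2 + b * x + c) = 3 / 8 * a + b / 2 + c"
proof -
  have i [simp]: "integrable P (\<lambda>x. x)" "integrable P (\<lambda>x. x\<^sup>2)"
    by (rule integrable_continuous, intro continuous_intros)+
  have [simp]: "measure P UNIV = 1" using prob_space by simp
  have m: "(LINT x|P. x) = 1/2"
  proof -
    have "third False x = 1/3 * x" "third True x = 1/3 * x + 2/3" for x
      by (simp_all add: third_def)
    hence "(LINT x|P. x) = ((LINT x|P. 1/3 * x) + (LINT x|P. 1/3 * x + 2/3)) / 2"
      using integral_halves[OF i(1)] by presburger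
    thus ?thesis by simp
  qed
  have "(third False x)\<^sup>2 = 1/9 * x\<^sup>2" "(third True x)\<^sup>2 = 1/9 * x\<^sup>2 + 4/9 * x + 4/9" for x
    by (simp_all add: third_def power2_eq_square field_simps)
  hence "(LINT x|P. x\<^sup>2) = ((LINT x|P. 1/9 * x\<^sup>2) + (LINT x|P. 1/9 * x\<^sup>2 + 4/9 * x + 4/9)) / 2"
    using integral_halves[OF i(2)] by presburger
  hence q: "(LINT x|P. x\<^sup>2) = 3/8" by (simp add: m)
  have "(LINT x|P. a * x\<^sup>2 + b * x + c) = a * (LINT x|P. x\<^sup>2) + b * (LINT x|P. x) + c" by simp
  thus ?thesis unfolding m q by simp
qed

lemma integral_diff_squares:
  "(LINT x|P. (p * x + q)\<^sup>2 - m * (u * x + w)\<^sup>2) = p\<^sup>2 / 8 + (p / 2 + q)\<^sup>2 - m * (u\<^sup>2 / 8 + (u / 2 + w)\<^sup>2)"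
proof -
  have "(p * x + q)\<^sup>2 - m * (u * x + w)\<^sup>2
      = (p\<^sup>2 - m * u\<^sup>2) * x\<^sup>2 + (2 * p * q - m * (2 * u * w)) * x + (q\<^sup>2 - m * w\<^sup>2)" for x
    by algebra
  hence "(LINT x|P. (p * x + q)\<^sup>2 - m * (u * x + w)\<^sup>2)
      = 3 / 8 * (p\<^sup>2 - m * u\<^sup>2) + (2 * p * q - m * (2 * u * w)) / 2 + (q\<^sup>2 - m * w\<^sup>2)"
    by (simp only: integral_quadratic)
  thus ?thesis by (simp add: power2_eq_square field_simps)
qed

lemma integral_square: "(LINT x|P. (p * x + q)\<^sup>2) = p\<^sup>2 / 8 + (p / 2 + q)\<^sup>2"
  using integral_diff_squares[of p q 0] by simp

end

section \<open>Distortion\<close>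

definition unthird :: "bool \<Rightarrow> real \<Rightarrow> real" where
  "unthird b a = 3 * a - (if b then 2 else 0)"

lemma third_minus: "third b x - a = (x - unthird b a) / 3"
  by (simp add: third_def unthird_def)

lemma continuous_on_Min_squares:
  fixes A :: "real set"
  assumes "finite A" "A \<noteq> {}"
  shows "continuous_on UNIV (\<lambda>x. MIN c\<in>A. (x - c)\<^sup>2)"
  using assms
proof (induction A rule: finite_ne_induct)
  case (insert a A)
  hence "(\<lambda>x. MIN c\<in>insert a A. (x - c)\<^sup>2) = (\<lambda>x. min ((x - a)\<^sup>2) (MIN c\<in>A. (x - c)\<^sup>2))"
    by (simp add: fun_eq_iff)
  moreover have "continuous_on UNIV (\<lambda>x. min ((x - a)\<^sup>2) (MIN c\<in>A. (x - c)\<^sup>2))"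
    by (rule continuous_on_min) (use insert.IH in \<open>auto intro!: continuous_intros\<close>)
  ultimately show ?case by (simp only:)
qed (auto intro!: continuous_intros)

context cantor_law
begin

text \<open>
  The only tool used for comparing point sets: whenever each point of \<open>A\<close> can be replaced, seen from
  any place in \<open>[0, 1]\<close>, by a point of \<open>B\<close> that is no farther away, \<open>B\<close> quantizes at least as well.
\<close>

lemma distortion_mono:
  assumes "finite A" "A \<noteq> {}" "finite B" "B \<noteq> {}"
    and "\<And>x a. x \<in> {0..1} \<Longrightarrow> a \<in> A \<Longrightarrow> \<exists>b\<in>B. \<bar>x - b\<bar> \<le> \<bar>x - a\<bar>"
  shows "distortion P B \<le> distortion P A"
  unfolding distortion_def
proof (rule integral_continuous_mono)
  fix x :: real assume x: "x \<in> {0..1}"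
  show "(MIN c\<in>B. (x - c)\<^sup>2) \<le> (MIN c\<in>A. (x - c)\<^sup>2)"
  proof (subst Min_ge_iff)
    show "\<forall>a\<in>(\<lambda>c. (x - c)\<^sup>2) ` A. (MIN c\<in>B. (x - c)\<^sup>2) \<le> a"
    proof clarify
      fix a assume "a \<in> A"
      then obtain b where b: "b \<in> B" "\<bar>x - b\<bar> \<le> \<bar>x - a\<bar>" using assms(5) x by blast
      have "(MIN c\<in>B. (x - c)\<^sup>2) \<le> (x - b)\<^sup>2" using b(1) assms(3) by (intro Min_le) auto
      also have "\<dots> \<le> (x - a)\<^sup>2" using b(2) by (simp add: abs_le_square_iff)
      finally show "(MIN c\<in>B. (x - c)\<^sup>2) \<le> (x - a)\<^sup>2" .
    qed
  qed (use assms in auto)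
qed (use assms continuous_on_Min_squares in auto)

lemma distortion_single: "distortion P {a} = 1/8 + (a - 1/2)\<^sup>2"
  using integral_square[of 1 "-a"] by (simp add: distortion_def power2_commute)

text \<open>
  The scaling identity behind the induction.  It is exact for every \<open>A\<close>, since all points of \<open>A\<close> are
  kept in both rescaled copies.
\<close>

lemma distortion_halves:
  assumes "finite A" "A \<noteq> {}"
  shows "distortion P A = (distortion P (unthird False ` A) + distortion P (unthird True ` A)) / 18"
proof -
  let ?m = "\<lambda>A x. MIN c\<in>A. (x - c)\<^sup>2"
  have "?m A (third b x) = ?m (unthird b ` A) x / 9" for b x
  proof -
    have "(third b x - c)\<^sup>2 = (x - unthird b c)\<^sup>2 / 9" for c
      by (simp add: third_minus power_divide)
    hence "?m A (third b x) = Min ((\<lambda>y. y / 9) ` (\<lambda>c. (x - c)\<^sup>2) ` unthird b ` A)"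
      by (simp only: image_image)
    also have "\<dots> = ?m (unthird b ` A) x / 9"
      by (rule mono_Min_commute[symmetric]) (use assms in \<open>auto simp: mono_def\<close>)
    finally show ?thesis .
  qed
  hence "(LINT x|P. ?m A (third b x)) = distortion P (unthird b ` A) / 9" for b
    by (simp only: distortion_def) simp
  thus ?thesis
    using integral_halves[OF integrable_continuous[OF continuous_on_Min_squares[OF assms]]]
    by (simp only: distortion_def[of P A]) simp
qed

lemma distortion_nonneg: "distortion P A \<ge> 0" if "finite A" "A \<noteq> {}"
proof -
  have "0 \<le> (MIN c\<in>A. (x - c)\<^sup>2)" for x using that by (subst Min_ge_iff) auto
  thus ?thesis unfolding distortion_def by (intro Bochner_Integration.integral_nonneg) auto
qed

end

section \<open>The affine lower bounds\<close>

text \<open>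
  For \<open>l \<ge> 1\<close> this is the affine function of \<open>n\<close> that interpolates the quantization error between
  \<open>2 ^ (l - 1)\<close> and \<open>2 ^ l\<close>.  For \<open>l = 0\<close> it takes the value \<open>1/8\<close>, the variance, at \<open>n = 1\<close> and is negative from
  \<open>n = 2\<close> on.
\<close>

definition chord :: "nat \<Rightarrow> nat \<Rightarrow> real" where
  "chord l n = (17 * 2 ^ l - 16 * real n) / (8 * 18 ^ l)"

lemma chord_Suc: "chord (Suc l) (a + b) = (chord l a + chord l b) / 18"
  by (simp add: chord_def field_simps)

lemma chord_antimono: "m \<le> n \<Longrightarrow> chord l n \<le> chord l m"
  by (auto simp: chord_def intro!: divide_right_mono)

lemma chord_le: "chord l n \<le> 17 / (8 * 9 ^ l)"
proof -
  have "chord l n \<le> 17 * 2 ^ l / (8 * 18 ^ l)"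
    unfolding chord_def by (intro divide_right_mono) auto
  also have "(18::real) ^ l = 2 ^ l * 9 ^ l" by (simp flip: power_mult_distrib)
  finally show ?thesis by (simp add: field_simps)
qed

text \<open>
  The right-hand sides are the quantization errors for 1 to 4 points.  From \<open>l = 4\<close> on the crude
  bound \<open>chord_le\<close> suffices.
\<close>

lemma chord_1: "chord l 1 \<le> 1/8" and chord_2: "chord l 2 \<le> 1/72"
  and chord_3: "chord l 3 \<le> 5/648" and chord_4: "chord l 4 \<le> 1/648"
proof -
  consider "l = 0" | "l = 1" | "l = 2" | "l = 3" | "l \<ge> 4" by linarith
  hence "chord l 1 \<le> 1/8 \<and> chord l 2 \<le> 1/72 \<and> chord l 3 \<le> 5/648 \<and> chord l 4 \<le> 1/648"
  proof cases
    case 5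
    hence "(9::real) ^ 4 \<le> 9 ^ l" by (intro power_increasing) auto
    hence "17 / (8 * 9 ^ l) \<le> (17 / (8 * 9 ^ 4) :: real)" by (intro divide_left_mono) auto
    moreover have "17 / (8 * 9 ^ 4) \<le> (1/648 :: real)" by simp
    ultimately have "chord l n \<le> 1/648" for n using chord_le[of l n] by linarith
    from this[of 1] this[of 2] this[of 3] this[of 4] show ?thesis by simp
  qed (simp_all add: chord_def)
  thus "chord l 1 \<le> 1/8" "chord l 2 \<le> 1/72" "chord l 3 \<le> 5/648" "chord l 4 \<le> 1/648"
    by auto
qed

section \<open>A far point on the left\<close>

text \<open>
  The gain of the point \<open>-1/2\<close> over \<open>r\<close> at \<open>y\<close> is the positive part of \<open>(r + 1/2) * u\<close> with
  \<open>u = r - 1/2 - 2 * y\<close>.  The parabola \<open>(u + e)\<^sup>2 / (4 * e)\<close>, which touches the line at \<open>u = e\<close>, is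
  an upper bound for the positive part of \<open>u\<close> that can be integrated exactly.
\<close>

lemma min_squares_ge:
  fixes r e y :: real
  assumes "r \<ge> 0" "e > 0"
  shows "(y - r)\<^sup>2 - (r + 1/2) / (4 * e) * (r - 1/2 - 2 * y + e)\<^sup>2 \<le> min ((y + 1/2)\<^sup>2) ((y - r)\<^sup>2)"
proof -
  let ?u = "r - 1/2 - 2 * y"
  have "4 * e * ?u \<le> (?u + e)\<^sup>2"
    using zero_le_power2[of "?u - e"] by (simp add: power2_eq_square algebra_simps)
  hence "?u \<le> (?u + e)\<^sup>2 / (4 * e)" using assms by (simp add: field_simps)
  hence "(r + 1/2) * ?u \<le> (r + 1/2) * ((?u + e)\<^sup>2 / (4 * e))"
    using assms by (intro mult_left_mono) auto
  moreover have "(r + 1/2) * ?u = (y - r)\<^sup>2 - (y + 1/2)\<^sup>2"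
    by (simp add: power2_eq_square algebra_simps)
  moreover have "(r + 1/2) / (4 * e) * (?u + e)\<^sup>2 \<ge> 0" using assms by auto
  ultimately show ?thesis by auto
qed

context cantor_law
begin

text \<open>
  Without the point \<open>-1/2\<close> the distortion is \<open>1/8 + d\<^sup>2\<close>, where \<open>d = r - 1/2\<close>.  The point lowers it
  by at most \<open>1/144 + d\<^sup>2\<close>.  The distortion can indeed fall below \<open>1/8\<close> for small \<open>d\<close>, so that this half of
  the configuration does not satisfy the one-point bound; the missing \<open>1/144\<close> is made up for by
  the other half, see \<open>distortion_with_one\<close>.
\<close>

lemma distortion_minus_half_pair:
  assumes "1/2 < r" "r \<le> 1"
  shows "17/144 \<le> distortion P {-1/2, r}"
proof -
  define h where "h x = min ((x + 1/2)\<^sup>2) ((x - r)\<^sup>2)" for x :: real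
  have h: "distortion P {-1/2, r} = (LINT x|P. h x)"
    using assms by (simp add: distortion_def h_def)
  have ch: "continuous_on UNIV (\<lambda>x. h (f x))" if "continuous_on UNIV f" for f
    unfolding h_def by (intro continuous_intros continuous_on_min that)
  have ct [continuous_intros]: "continuous_on UNIV (\<lambda>x. third b (f x))"
    if "continuous_on UNIV f" for b and f :: "real \<Rightarrow> real"
    unfolding third_def by (intro continuous_intros that) auto
  have split: "(LINT x|P. h (f x)) = ((LINT x|P. h (f (third False x))) + (LINT x|P. h (f (third True x)))) / 2"
    if "continuous_on UNIV f" for f
    by (rule integral_halves, rule integrable_continuous, rule ch, rule that)
  have ge: "p\<^sup>2 / 8 + (p / 2 + (q - r))\<^sup>2 -
        (r + 1/2) / (4 * e) * ((- 2 * p)\<^sup>2 / 8 + ((- 2 * p) / 2 + (r - 1/2 - 2 * q + e))\<^sup>2)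
      \<le> (LINT x|P. h (p * x + q))" if "e > 0" for p q e
  proof -
    have "(LINT x|P. (p * x + (q - r))\<^sup>2 - (r + 1/2) / (4 * e) * ((- 2 * p) * x + (r - 1/2 - 2 * q + e))\<^sup>2)
       \<le> (LINT x|P. h (p * x + q))"
    proof (rule integral_continuous_mono)
      fix x :: real
      show "(p * x + (q - r))\<^sup>2 - (r + 1/2) / (4 * e) * ((- 2 * p) * x + (r - 1/2 - 2 * q + e))\<^sup>2
          \<le> h (p * x + q)"
      proof -
        have e: "p * x + (q - r) = p * x + q - r"
          "(- 2 * p) * x + (r - 1/2 - 2 * q + e) = r - 1/2 - 2 * (p * x + q) + e"
          by simp_all
        show ?thesis
          unfolding h_def e by (intro min_squares_ge) (use assms that in simp_all)
      qed
    qed (intro ch continuous_on_diff continuous_on_power continuous_on_mult continuous_on_add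
          continuous_on_const continuous_on_id)+
    thus ?thesis unfolding integral_diff_squares .
  qed
  have near: "p\<^sup>2 / 8 + (p / 2 + (q - r))\<^sup>2 \<le> (LINT x|P. h (p * x + q))"
    if "p \<ge> 0" "r - 1/2 \<le> 2 * q" for p q
  proof -
    have "(LINT x|P. (p * x + (q - r))\<^sup>2) \<le> (LINT x|P. h (p * x + q))"
    proof (rule integral_continuous_mono)
      fix x :: real assume "x \<in> {0..1}"
      hence "0 \<le> p * x" using that by simp
      hence "r - 1/2 - 2 * (p * x + q) \<le> 0" using that by argo
      hence "(r + 1/2) * (r - 1/2 - 2 * (p * x + q)) \<le> 0" using assms by (simp add: mult_nonneg_nonpos)
      moreover have "(r + 1/2) * (r - 1/2 - 2 * (p * x + q)) = (p * x + q - r)\<^sup>2 - (p * x + q + 1/2)\<^sup>2"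
        by (simp add: power2_eq_square algebra_simps)
      moreover have e: "p * x + (q - r) = p * x + q - r" by simp
      ultimately show "(p * x + (q - r))\<^sup>2 \<le> h (p * x + q)"
        unfolding h_def e min.bounded_iff by linarith
    qed (intro ch continuous_on_diff continuous_on_power continuous_on_mult continuous_on_add
          continuous_on_const continuous_on_id)+
    thus ?thesis unfolding integral_square .
  qed
  have s1: "(LINT x|P. h x) = ((LINT x|P. h (third False x)) + (LINT x|P. h (third True x))) / 2"
    by (rule split) (rule continuous_intros)
  have third2: "third True = (\<lambda>x. 1/3 * x + 2/3)"
    by (auto simp: third_def fun_eq_iff)
  define d where "d = r - 1/2"
  have r: "r = d + 1/2" and d: "0 \<le> d" "d \<le> 1/2" using assms by (auto simp: d_def)
  have "1/72 + (1/3 - d)\<^sup>2 \<le> (LINT x|P. h (1/3 * x + 2/3))"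
    using near[of "1/3" "2/3"] d by (simp add: r power2_eq_square)
  hence right: "1/72 + (1/9 - 2/3 * d + d\<^sup>2) \<le> (LINT x|P. h (third True x))"
    by (simp add: third2 power2_eq_square algebra_simps)
  show ?thesis
  proof (cases "d \<le> 4/9")
    case True
    \<comment> \<open>The gain is confined to \<open>y \<le> d/2 \<le> 2/9\<close>, hence to the cell \<open>[0, 1/9]\<close>; the parabola is
      taken there with \<open>e = 1/9\<close>.\<close>
    have "(LINT x|P. h (third False x)) =
        ((LINT x|P. h (third False (third False x))) + (LINT x|P. h (third False (third True x)))) / 2"
      by (rule split) (use ct[OF continuous_on_id] in simp)
    moreover have "1/648 + (2/9 + d)\<^sup>2 \<le> (LINT x|P. h (1/9 * x + 2/9))"
      using near[of "1/9" "2/9"] True by (simp add: r power2_eq_square algebra_simps)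
    hence "1/648 + (4/81 + 4/9 * d + d\<^sup>2) \<le> (LINT x|P. h (third False (third True x)))"
      by (simp add: third_def power2_eq_square algebra_simps add_divide_distrib)
    moreover have "1/648 + (4/9 + d)\<^sup>2 - 9/4 * ((1 + d) * (d\<^sup>2 + 1/162)) \<le> (LINT x|P. h (1/9 * x))"
      using ge[of "1/9" "1/9" 0] by (simp add: r power2_eq_square field_simps)
    hence "1/648 + (16/81 + 8/9 * d + d\<^sup>2) - 9/4 * ((1 + d) * (d\<^sup>2 + 1/162))
        \<le> (LINT x|P. h (third False (third False x)))"
      by (simp add: third_def power2_eq_square algebra_simps)
    moreover define X where "X = (1 + d) * (d\<^sup>2 + 1/162)"
    ultimately have "(LINT x|P. h x) \<ge> 1/8 + d\<^sup>2 - 9/16 * X"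
      using right s1 unfolding X_def[symmetric] by argo
    hence lower: "(LINT x|P. h x) \<ge> 1/8 + d\<^sup>2 - 9/16 * ((1 + d) * (d\<^sup>2 + 1/162))" unfolding X_def .
    moreover
    have "d * d\<^sup>2 \<le> 4/9 * d\<^sup>2" using True by (intro mult_right_mono) auto
    moreover have "(1 + d) * (d\<^sup>2 + 1/162) = d\<^sup>2 + 1/162 + d * d\<^sup>2 + d / 162"
      by (simp add: algebra_simps)
    ultimately have "9/16 * ((1 + d) * (d\<^sup>2 + 1/162)) \<le> d\<^sup>2 + 1/144"
      using d zero_le_power2[of d] by linarith
    with lower show ?thesis using h by linarith
  next
    case False
    \<comment> \<open>Now \<open>d\<close> is so large that the coarse parabola with \<open>e = 1/3\<close> on \<open>[0, 1/3]\<close> is good enough.\<close>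
    have "1/72 + (1/3 + d)\<^sup>2 - 3/4 * ((1 + d) * (d\<^sup>2 + 1/18)) \<le> (LINT x|P. h (1/3 * x))"
      using ge[of "1/3" "1/3" 0] by (simp add: r power2_eq_square field_simps)
    hence "1/72 + (1/9 + 2/3 * d + d\<^sup>2) - 3/4 * ((1 + d) * (d\<^sup>2 + 1/18))
        \<le> (LINT x|P. h (third False x))"
      by (simp add: third_def power2_eq_square algebra_simps)
    moreover define Y where "Y = (1 + d) * (d\<^sup>2 + 1/18)"
    ultimately have "(LINT x|P. h x) \<ge> 1/8 + d\<^sup>2 - 3/8 * Y"
      using right s1 unfolding Y_def[symmetric] by argo
    hence "(LINT x|P. h x) \<ge> 1/8 + d\<^sup>2 - 3/8 * ((1 + d) * (d\<^sup>2 + 1/18))" unfolding Y_def .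
    moreover have "(1 + d) * (d\<^sup>2 + 1/18) \<le> 3/2 * (d\<^sup>2 + 1/18)"
      using d by (intro mult_right_mono) auto
    moreover have "(4/9)\<^sup>2 \<le> d\<^sup>2" using False by (intro power_mono) auto
    ultimately show ?thesis using h by (simp add: power_divide)
  qed
qed

end

section \<open>The lower bound\<close>

context cantor_law
begin

lemma distortion_ge_half_unthird:
  assumes "finite A" "A \<noteq> {}"
  shows "distortion P (unthird b ` A) / 18 \<le> distortion P A"
  using distortion_halves[OF assms] distortion_nonneg[of "unthird (\<not> b) ` A"] assms
  by (cases b) auto

text \<open>
  One third served only from across its border costs \<open>1/48\<close>, more than the \<open>1/72\<close> that two points
  achieve.  Seen from the left third, the best conceivable point is \<open>1\<close>.
\<close>

lemma distortion_ge_of_no_left: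
  assumes "finite A" "A \<noteq> {}" "\<And>a. a \<in> A \<Longrightarrow> 1/3 \<le> a"
  shows "1/48 \<le> distortion P A"
proof -
  have "distortion P {1} \<le> distortion P (unthird False ` A)"
    by (rule distortion_mono) (use assms in \<open>force simp: unthird_def\<close>)+
  thus ?thesis
    using distortion_ge_half_unthird[OF assms(1,2), of False] by (simp add: distortion_single power_divide)
qed

lemma distortion_ge_of_no_right:
  assumes "finite A" "A \<noteq> {}" "\<And>a. a \<in> A \<Longrightarrow> a \<le> 2/3"
  shows "1/48 \<le> distortion P A"
proof -
  have "distortion P {0} \<le> distortion P (unthird True ` A)"
    by (rule distortion_mono) (use assms in \<open>force simp: unthird_def\<close>)+
  thus ?thesis
    using distortion_ge_half_unthird[OF assms(1,2), of True] by (simp add: distortion_single power_divide)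
qed

text \<open>
  The point \<open>1\<close> stands for a point in the gap, seen from the left third.  The distortion exceeds the two-point
  error \<open>1/72\<close> by \<open>1/144\<close>, because \<open>1\<close> is a poor place for the second point.
\<close>

lemma distortion_with_one:
  assumes "0 \<le> a" "a \<le> 1"
  shows "1/48 \<le> distortion P {a, 1}"
proof (cases "a \<le> 1/3")
  case True
  have "distortion P {1} \<le> distortion P (unthird True ` {a, 1})"
    by (rule distortion_mono) (use True assms in \<open>auto simp: unthird_def\<close>)
  thus ?thesis
    using distortion_ge_half_unthird[of "{a, 1}" True] by (simp add: distortion_single power_divide)
next
  case False
  thus ?thesis by (intro distortion_ge_of_no_left) auto
qed

text \<open>
  If all other points lie right of \<open>1/2\<close>, then on \<open>[0, 1/3]\<close> the distance to \<open>1/2\<close> is the best one can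
  hope for.
\<close>

lemma distortion_minus_half_far:
  assumes "finite R" "\<And>r. r \<in> R \<Longrightarrow> 1/2 \<le> r"
  shows "1/16 \<le> distortion P (insert (-1/2) R)"
proof -
  have "distortion P {3/2} \<le> distortion P (unthird False ` insert (-1/2) R)"
    by (rule distortion_mono) (use assms in \<open>force simp: unthird_def\<close>)+
  thus ?thesis
    using distortion_ge_half_unthird[of "insert (-1/2) R" False] assms
    by (simp add: distortion_single)
qed

text \<open>
  The case of a single point \<open>c\<close> in the gap.  It is credited to the left third, where it acts at best
  like the border point \<open>1\<close>; seen from the right third it lies at \<open>-1/2\<close> or farther left.  If it is
  useless there, the induction hypothesis for \<open>card L + 1\<close> and \<open>card R\<close> points concludes.
  Otherwise no point of \<open>R\<close> reaches the left half of the right third, which is so wasteful that it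
  can only compete with the bound when \<open>R\<close> is a single point, and then only when \<open>L\<close> is one, too.
\<close>

lemma chord_le_gap_left:
  assumes IH: "\<And>B. finite B \<Longrightarrow> B \<noteq> {} \<Longrightarrow> chord l (card B) \<le> distortion P B"
    and L: "finite L" "L \<noteq> {}" "L \<subseteq> {0..1/3}" and R: "finite R" "R \<noteq> {}" "R \<subseteq> {2/3..1}"
    and c: "1/3 < c" "c \<le> 1/2"
  shows "chord (Suc l) (card L + card R + 1) \<le> distortion P (insert c (L \<union> R))"
proof -
  let ?A = "insert c (L \<union> R)"
  define L' where "L' = unthird False ` L"
  define R' where "R' = unthird True ` R"
  have L': "finite L'" "L' \<noteq> {}" "L' \<subseteq> {0..1}" and R': "finite R'" "R' \<noteq> {}" "R' \<subseteq> {0..1}"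
    using L R by (auto simp: L'_def R'_def unthird_def)
  have inj: "inj_on (unthird b) S" for b S by (auto simp: inj_on_def unthird_def)
  have cL: "card L' = card L" and cR: "card R' = card R"
    by (simp_all add: L'_def R'_def card_image inj)
  have split: "distortion P ?A = (distortion P (unthird False ` ?A) + distortion P (unthird True ` ?A)) / 18"
    using L by (intro distortion_halves) (auto simp: R)
  have "distortion P (insert 1 L') \<le> distortion P (unthird False ` ?A)"
  proof (rule distortion_mono)
    fix x a :: real assume x: "x \<in> {0..1}" and "a \<in> unthird False ` ?A"
    hence "a \<in> L' \<or> 1 \<le> a" using c R(3) by (auto simp: L'_def unthird_def)
    thus "\<exists>b\<in>insert 1 L'. \<bar>x - b\<bar> \<le> \<bar>x - a\<bar>" using x by auto
  qed (use L R L' in auto)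
  moreover have "distortion P (insert (-1/2) R') \<le> distortion P (unthird True ` ?A)"
  proof (rule distortion_mono)
    fix x a :: real assume x: "x \<in> {0..1}" and "a \<in> unthird True ` ?A"
    hence "a \<in> R' \<or> a \<le> -1/2" using c L(3) by (auto simp: R'_def unthird_def)
    thus "\<exists>b\<in>insert (-1/2) R'. \<bar>x - b\<bar> \<le> \<bar>x - a\<bar>" using x by auto
  qed (use L R R' in auto)
  ultimately have lower: "(distortion P (insert 1 L') + distortion P (insert (-1/2) R')) / 18 \<le> distortion P ?A"
    using split by simp
  have left: "chord l (card L + 1) \<le> distortion P (insert 1 L')"
  proof -
    have "card (insert 1 L') \<le> card L + 1" using card_insert_le_m1[of "card L + 1" L' 1] cL by simp
    hence "chord l (card L + 1) \<le> chord l (card (insert 1 L'))" by (rule chord_antimono)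
    also have "\<dots> \<le> distortion P (insert 1 L')" using L' by (intro IH) auto
    finally show ?thesis .
  qed
  have pos: "card L \<ge> 1" "card R \<ge> 1" using L R by (simp_all add: Suc_le_eq card_gt_0_iff)
  have ?thesis if "chord l (card R) \<le> distortion P (insert (-1/2) R')"
    using chord_Suc[of l "card L + 1" "card R"] left that lower by (simp add: add_ac)
  moreover have ?thesis if "\<not> chord l (card R) \<le> distortion P (insert (-1/2) R')"
  proof -
    \<comment> \<open>A point of \<open>R'\<close> in \<open>[0, 1/2]\<close> would be nearer than \<open>-1/2\<close> everywhere on \<open>[0, 1]\<close>.\<close>
    have far: "1/2 < r" if "r \<in> R'" for r
    proof (rule ccontr)
      assume "\<not> 1/2 < r"
      hence "distortion P R' \<le> distortion P (insert (-1/2) R')"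
      proof (intro distortion_mono)
        fix x a :: real assume "x \<in> {0..1}" "a \<in> insert (-1/2) R'"
        hence "a \<in> R' \<or> \<bar>x - r\<bar> \<le> \<bar>x - a\<bar>" using \<open>\<not> 1/2 < r\<close> that R' by auto
        thus "\<exists>b\<in>R'. \<bar>x - b\<bar> \<le> \<bar>x - a\<bar>" using that by blast
      qed (use R' in auto)
      moreover have "chord l (card R) \<le> distortion P R'" using IH[OF R'(1,2)] cR by simp
      ultimately show False using \<open>\<not> chord l (card R) \<le> _\<close> by simp
    qed
    hence far16: "1/16 \<le> distortion P (insert (-1/2) R')"
      using R' by (intro distortion_minus_half_far) force+
    have "card R = 1"
    proof (rule ccontr)
      assume "card R \<noteq> 1"
      hence "chord l (card R) \<le> chord l 2" using pos by (intro chord_antimono) simp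
      thus False using chord_2[of l] far16 \<open>\<not> chord l (card R) \<le> _\<close> by linarith
    qed
    show ?thesis
    proof (cases "card L = 1")
      case True
      \<comment> \<open>Three points: \<open>(1/48 + 17/144) / 18\<close> is exactly the bound \<open>5/648\<close>.\<close>
      obtain a where a: "L' = {a}" using True cL by (auto simp: card_1_singleton_iff)
      obtain r where r: "R' = {r}" using \<open>card R = 1\<close> cR by (auto simp: card_1_singleton_iff)
      have "1/48 \<le> distortion P (insert 1 L')"
        using distortion_with_one[of a] a L' by (simp add: insert_commute)
      moreover have "17/144 \<le> distortion P (insert (-1/2) R')"
        using distortion_minus_half_pair[of r] r R' far by simp
      moreover have "chord (Suc l) (card L + card R + 1) \<le> 5/648"
        using chord_3[of "Suc l"] True \<open>card R = 1\<close> by (simp add: numeral_3_eq_3)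
      ultimately show ?thesis using lower by argo
    next
      case False
      hence "chord (Suc l) (card L + card R + 1) \<le> chord (Suc l) 4"
        using pos by (intro chord_antimono) simp
      moreover have "0 \<le> distortion P (insert 1 L')" using L' by (intro distortion_nonneg) auto
      ultimately show ?thesis using chord_4[of "Suc l"] far16 lower by argo
    qed
  qed
  ultimately show ?thesis by blast
qed

end

lemma third_reflect: "1 - third b x = third (\<not> b) (1 - x)"
  by (cases b) (simp_all add: third_def field_simps)

text \<open>
  Reflection exchanges the two maps.  The reflected measure is again governed by the locale, which
  reduces a gap point in the right half of the gap to one in the left half without any appeal to
  the uniqueness of the measure.
\<close>

lemma (in cantor_law) cantor_law_reflect: "cantor_law (distr P borel (\<lambda>x. 1 - x))"
proof -
  have [measurable]: "(\<lambda>x. 1 - x) \<in> P \<rightarrow>\<^sub>M (borel :: real measure)" by measurable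
  interpret R: prob_space "distr P borel (\<lambda>x. 1 - x)" by (rule prob_space_distr) measurable
  show ?thesis
  proof
    fix A :: "real set" assume A [measurable]: "A \<in> sets borel"
    have md: "measure (distr P borel (\<lambda>x. 1 - x)) B = measure P ((\<lambda>x. 1 - x) -` B)"
      if "B \<in> sets borel" for B using that by (simp add: measure_distr)
    have s: "(\<lambda>x. 1 - x) -` A \<in> sets borel" "third b -` A \<in> sets borel" for b
      using measurable_sets[OF _ A, of "\<lambda>x. 1 - x" borel] measurable_sets[OF third_measurable A, of b]
      by simp_all
    have "third b -` (\<lambda>x. 1 - x) -` A = (\<lambda>x. 1 - x) -` third (\<not> b) -` A" for b
      by (simp add: vimage_def third_reflect)
    thus "measure (distr P borel (\<lambda>x. 1 - x)) A = (measure (distr P borel (\<lambda>x. 1 - x)) (third False -` A)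
         + measure (distr P borel (\<lambda>x. 1 - x)) (third True -` A)) / 2"
      using halves[OF s(1)] by (simp add: md A s)
  qed simp
qed

lemma (in cantor_law) distortion_reflect:
  assumes "finite A" "A \<noteq> {}"
  shows "distortion (distr P borel (\<lambda>x. 1 - x)) A = distortion P ((\<lambda>x. 1 - x) ` A)"
proof -
  have m: "(\<lambda>x. MIN c\<in>A. (x - c)\<^sup>2) \<in> borel_measurable borel"
    by (rule borel_measurable_continuous_onI[OF continuous_on_Min_squares[OF assms]])
  have "(1 - x - c)\<^sup>2 = (x - (1 - c))\<^sup>2" for x c :: real
    by (simp add: power2_eq_square algebra_simps)
  hence "(MIN c\<in>A. (1 - x - c)\<^sup>2) = (MIN c\<in>(\<lambda>x. 1 - x) ` A. (x - c)\<^sup>2)" for x :: real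
    by (simp only: image_image)
  moreover have "distortion (distr P borel (\<lambda>x. 1 - x)) A = (LINT x|P. (MIN c\<in>A. (1 - x - c)\<^sup>2))"
    unfolding distortion_def by (rule integral_distr[OF _ m]) measurable
  ultimately show ?thesis by (simp only: distortion_def[of P])
qed

context cantor_law
begin

lemma chord_le_gap_right:
  assumes IH: "\<And>B. finite B \<Longrightarrow> B \<noteq> {} \<Longrightarrow> chord l (card B) \<le> distortion P B"
    and L: "finite L" "L \<noteq> {}" "L \<subseteq> {0..1/3}" and R: "finite R" "R \<noteq> {}" "R \<subseteq> {2/3..1}"
    and c: "1/2 \<le> c" "c < 2/3"
  shows "chord (Suc l) (card L + card R + 1) \<le> distortion P (insert c (L \<union> R))"
proof -
  let ?r = "\<lambda>x::real. 1 - x"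
  interpret R: cantor_law "distr P borel ?r" by (rule cantor_law_reflect)
  have card: "card (?r ` B) = card B" for B by (intro card_image) (auto simp: inj_on_def)
  have "chord (Suc l) (card (?r ` R) + card (?r ` L) + 1)
      \<le> distortion (distr P borel ?r) (insert (?r c) (?r ` R \<union> ?r ` L))"
  proof (rule R.chord_le_gap_left)
    fix B :: "real set" assume B: "finite B" "B \<noteq> {}"
    show "chord l (card B) \<le> distortion (distr P borel ?r) B"
      using IH[of "?r ` B"] B by (simp add: distortion_reflect card)
  qed (use L R c in auto)
  also have "\<dots> = distortion P (insert c (L \<union> R))"
    using L R by (simp add: distortion_reflect image_Un image_image Un_commute)
  finally show ?thesis by (simp add: card add.commute)
qed

text \<open>
  The induction step for sets inside \<open>[0, 1]\<close>; the restriction ensures that a point of one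
  outer third is never nearer to the opposite third than a point there.
\<close>

lemma chord_le_unit:
  assumes IH: "\<And>B. finite B \<Longrightarrow> B \<noteq> {} \<Longrightarrow> chord l (card B) \<le> distortion P B"
    and A: "finite A" "A \<noteq> {}" "A \<subseteq> {0..1}"
  shows "chord (Suc l) (card A) \<le> distortion P A"
proof -
  define L where "L = {a\<in>A. a \<le> 1/3}"
  define R where "R = {a\<in>A. 2/3 \<le> a}"
  define G where "G = {a\<in>A. 1/3 < a \<and> a < 2/3}"
  have A_eq: "A = G \<union> (L \<union> R)" by (auto simp: L_def R_def G_def)
  have fin: "finite L" "finite R" "finite G" using A by (auto simp: L_def R_def G_def)
  have L: "L \<subseteq> {0..1/3}" and R: "R \<subseteq> {2/3..1}" using A(3) by (auto simp: L_def R_def)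
  have card_A: "card A = card G + (card L + card R)"
  proof -
    have "L \<inter> R = {}" "G \<inter> (L \<union> R) = {}" by (auto simp: L_def R_def G_def)
    thus ?thesis using fin by (subst A_eq) (simp add: card_Un_disjoint)
  qed
  show ?thesis
  proof (cases "card A = 1")
    case True
    then obtain a where "A = {a}" by (auto simp: card_1_singleton_iff)
    hence "distortion P A \<ge> 1/8" by (simp add: distortion_single)
    thus ?thesis using chord_1[of "Suc l"] unfolding \<open>card A = 1\<close> by linarith
  next
    case False
    hence "card A \<ge> 2" using A by (metis One_nat_def Suc_1 Suc_leI card_gt_0_iff le_neq_implies_less)
    hence le72: "chord (Suc l) (card A) \<le> 1/72"
      using chord_antimono[of 2 "card A" "Suc l"] chord_2[of "Suc l"] by linarith
    show ?thesis
    proof (cases "L = {} \<or> R = {}")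
      case True
      hence "1/48 \<le> distortion P A"
      proof
        assume "L = {}"
        thus ?thesis using A by (intro distortion_ge_of_no_left) (auto simp: L_def intro: less_imp_le)
      next
        assume "R = {}"
        thus ?thesis using A by (intro distortion_ge_of_no_right) (auto simp: R_def intro: less_imp_le)
      qed
      thus ?thesis using le72 by linarith
    next
      case False
      hence ne: "L \<noteq> {}" "R \<noteq> {}" by auto
      have inj: "inj_on (unthird b) S" for b S by (auto simp: inj_on_def unthird_def)
      have split: "distortion P A = (distortion P (unthird False ` A) + distortion P (unthird True ` A)) / 18"
        using A by (intro distortion_halves)
      \<comment> \<open>The two halves decouple once the gap points have been replaced by \<open>S\<close> for the left third
        and by \<open>T\<close> for the right third; the total number of points must not grow.\<close>
      have separated: ?thesis if "card L + card S + (card R + card T) \<le> card A"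
        "finite S" "finite T"
        "\<And>x a. x \<in> {0..1} \<Longrightarrow> a \<in> G \<Longrightarrow> \<exists>b\<in>unthird False ` L \<union> S. \<bar>x - b\<bar> \<le> \<bar>x - unthird False a\<bar>"
        "\<And>x a. x \<in> {0..1} \<Longrightarrow> a \<in> G \<Longrightarrow> \<exists>b\<in>unthird True ` R \<union> T. \<bar>x - b\<bar> \<le> \<bar>x - unthird True a\<bar>"
        for S T
      proof -
        let ?L = "unthird False ` L \<union> S" and ?R = "unthird True ` R \<union> T"
        obtain a0 b0 where ab: "a0 \<in> L" "b0 \<in> R" using ne by auto
        have "distortion P ?L \<le> distortion P (unthird False ` A)"
        proof (rule distortion_mono)
          fix x a :: real assume x: "x \<in> {0..1}" and "a \<in> unthird False ` A"
          then obtain a' where a': "a = unthird False a'" "a' \<in> A" by auto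
          consider "a' \<in> G" | "a' \<in> L" | "a' \<in> R" using a' A_eq by blast
          thus "\<exists>b\<in>?L. \<bar>x - b\<bar> \<le> \<bar>x - a\<bar>"
          proof cases
            case 3
            hence "\<bar>x - unthird False a0\<bar> \<le> \<bar>x - a\<bar>"
              using x a' R L ab by (force simp: unthird_def)
            thus ?thesis using ab by blast
          qed (use that(4) x a' in auto)
        qed (use A fin ne that in auto)
        moreover have "distortion P ?R \<le> distortion P (unthird True ` A)"
        proof (rule distortion_mono)
          fix x a :: real assume x: "x \<in> {0..1}" and "a \<in> unthird True ` A"
          then obtain a' where a': "a = unthird True a'" "a' \<in> A" by auto
          consider "a' \<in> G" | "a' \<in> L" | "a' \<in> R" using a' A_eq by blast
          thus "\<exists>b\<in>?R. \<bar>x - b\<bar> \<le> \<bar>x - a\<bar>"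
          proof cases
            case 2
            hence "\<bar>x - unthird True b0\<bar> \<le> \<bar>x - a\<bar>"
              using x a' R L ab by (force simp: unthird_def)
            thus ?thesis using ab by blast
          qed (use that(5) x a' in auto)
        qed (use A fin ne that in auto)
        moreover have "chord l (card ?L) \<le> distortion P ?L" "chord l (card ?R) \<le> distortion P ?R"
          using fin ne that by (auto intro!: IH)
        ultimately have "(chord l (card ?L) + chord l (card ?R)) / 18 \<le> distortion P A"
          using split by argo
        moreover have "card ?L + card ?R \<le> card A"
          using card_Un_le[of "unthird False ` L" S] card_Un_le[of "unthird True ` R" T] that(1)
          by (simp add: card_image inj)
        hence "chord (Suc l) (card A) \<le> chord (Suc l) (card ?L + card ?R)" by (rule chord_antimono)
        ultimately show ?thesis by (simp add: chord_Suc)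
      qed
      consider "G = {}" | c where "G = {c}" | "card G \<ge> 2"
        by (metis One_nat_def card_1_singletonE card_0_eq fin(3) le_less_linear less_2_cases)
      thus ?thesis
      proof cases
        case 1
        thus ?thesis using separated[of "{}" "{}"] card_A by simp
      next
        case 2
        hence c: "1/3 < c" "c < 2/3" by (auto simp: G_def)
        have "A = insert c (L \<union> R)" "card A = card L + card R + 1" using A_eq card_A 2 by auto
        thus ?thesis
          using chord_le_gap_left[OF IH fin(1) ne(1) L fin(2) ne(2) R c(1)]
            chord_le_gap_right[OF IH fin(1) ne(1) L fin(2) ne(2) R _ c(2)]
          by (cases "c \<le> 1/2") auto
      next
        case 3
        \<comment> \<open>Two gap points pay for the two border points of the gap, which serve both sides better.\<close>
        show ?thesis
        proof (rule separated[of "{1}" "{0}"])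
          show "card L + card {1::real} + (card R + card {0::real}) \<le> card A" using 3 card_A by simp
        qed (auto simp: G_def unthird_def)
      qed
    qed
  qed
qed

text \<open>
  At \<open>l = 0\<close> only a single point has to be considered, and there the bound is the variance.
\<close>

lemma chord_le_distortion:
  assumes "finite A" "A \<noteq> {}"
  shows "chord l (card A) \<le> distortion P A"
  using assms
proof (induction l arbitrary: A)
  case 0
  show ?case
  proof (cases "card A = 1")
    case True
    then obtain a where "A = {a}" by (auto simp: card_1_singleton_iff)
    thus ?thesis by (simp add: chord_def distortion_single)
  next
    case False
    hence "card A \<ge> 2" using 0 by (metis One_nat_def Suc_1 Suc_leI card_gt_0_iff le_neq_implies_less)
    hence "chord 0 (card A) \<le> 0" by (simp add: chord_def)
    thus ?thesis using distortion_nonneg[OF 0] by linarith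
  qed
next
  case (Suc l)
  let ?clamp = "\<lambda>a. max 0 (min 1 a) :: real"
  have "chord (Suc l) (card A) \<le> chord (Suc l) (card (?clamp ` A))"
    using Suc.prems by (intro chord_antimono card_image_le)
  also have "\<dots> \<le> distortion P (?clamp ` A)"
    by (rule chord_le_unit) (use Suc in auto)
  also have "\<dots> \<le> distortion P A"
  proof (rule distortion_mono)
    fix x a :: real assume "x \<in> {0..1}" "a \<in> A"
    hence "\<bar>x - ?clamp a\<bar> \<le> \<bar>x - a\<bar>" by auto
    thus "\<exists>b\<in>?clamp ` A. \<bar>x - b\<bar> \<le> \<bar>x - a\<bar>" using \<open>a \<in> A\<close> by blast
  qed (use Suc.prems in auto)
  finally show ?case .
qed

end

section \<open>Cantor cells and the upper bound\<close>

definition thirds :: "bool list \<Rightarrow> real \<Rightarrow> real" where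
  "thirds t = foldr third t"

definition mid :: "bool list \<Rightarrow> real" where
  "mid t = thirds t (1/2)"

lemma thirds_Nil [simp]: "thirds [] x = x"
  and thirds_Cons [simp]: "thirds (b # t) x = third b (thirds t x)"
  and thirds_append [simp]: "thirds (t @ u) x = thirds t (thirds u x)"
  by (simp_all add: thirds_def)

lemma thirds_affine: "thirds t x = mid t + (x - 1/2) / 3 ^ length t"
  by (induction t) (simp_all add: mid_def third_def field_simps)

lemma continuous_on_thirds: "continuous_on S (thirds t)"
  unfolding thirds_affine[abs_def] by (intro continuous_intros) auto

lemma thirds_mem: "x \<in> {0..1} \<Longrightarrow> thirds t x \<in> {0..1}"
  by (induction t) (simp_all only: thirds_Nil thirds_Cons third_mem)

lemma mid_bounds: "0 < mid t" "mid t < 1"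
  by (induction t) (auto simp: mid_def third_def)

lemma mid_Nil: "mid [] = 1/2"
  and mid_Cons: "mid (b # t) = third b (mid t)"
  by (simp_all add: mid_def)

text \<open>
  The first binary digit of a nonempty word can be read off from the side of \<open>1/2\<close> on which its
  midpoint lies.
\<close>

lemma inj_mid: "inj mid"
proof (rule injI)
  have side: "mid (b # t) \<noteq> 1/2" "mid (b # t) < 1/2 \<longleftrightarrow> \<not> b" for b t
    using mid_bounds[of t] by (auto simp: mid_Cons third_def)
  fix t u show "mid t = mid u \<Longrightarrow> t = u"
  proof (induction t arbitrary: u)
    case Nil
    thus ?case using side(1) by (cases u) (auto simp: mid_Nil)
  next
    case (Cons b t)
    then obtain b' u' where u: "u = b' # u'" using side(1)[of b t] by (cases u) (auto simp: mid_Nil)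
    have "b = b'" using Cons.prems side(2) unfolding u by metis
    moreover have "mid t = mid u'" using Cons.prems \<open>b = b'\<close> by (simp add: u mid_Cons third_def)
    ultimately show ?case using Cons.IH by (simp add: u)
  qed
qed

lemma finite_lists_length: "finite {t :: bool list. length t = l}"
  and card_lists_length: "card {t :: bool list. length t = l} = 2 ^ l"
  using finite_lists_length_eq[of "UNIV :: bool set" l] card_lists_length_eq[of "UNIV :: bool set" l]
  by simp_all

context cantor_law
begin

lemma integral_thirds_sum:
  fixes f :: "real \<Rightarrow> real"
  assumes "continuous_on UNIV f"
  shows "(LINT x|P. f x) = (\<Sum>t | length t = l. LINT x|P. f (thirds t x)) / 2 ^ l"
  using assms
proof (induction l arbitrary: f)
  case 0
  thus ?case by simp
next
  case (Suc l)
  let ?L = "{t :: bool list. length t = l}"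
  have c: "continuous_on UNIV (\<lambda>x. f (third b x))" for b
    by (rule continuous_on_compose2[OF Suc.prems]) (auto simp: third_def intro!: continuous_intros)
  have "{t :: bool list. length t = Suc l} = (#) False ` ?L \<union> (#) True ` ?L"
    by (auto simp: length_Suc_conv image_iff)
  hence "(\<Sum>t | length t = Suc l. LINT x|P. f (thirds t x))
      = (\<Sum>t\<in>?L. LINT x|P. f (third False (thirds t x))) + (\<Sum>t\<in>?L. LINT x|P. f (third True (thirds t x)))"
    by (simp only:) (subst sum.union_disjoint, auto simp: finite_lists_length sum.reindex)
  also have "\<dots> = 2 ^ l * (LINT x|P. f (third False x)) + 2 ^ l * (LINT x|P. f (third True x))"
    using Suc.IH[OF c] by simp
  finally show ?case
    by (simp only: integral_halves[OF integrable_continuous[OF Suc.prems]]) (simp add: field_simps)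
qed

lemma cell_distortion_le:
  assumes "finite A" "mid t \<in> A"
  shows "(LINT x|P. (MIN c\<in>A. (thirds t x - c)\<^sup>2)) \<le> 1 / (8 * 9 ^ length t)"
proof -
  have "(LINT x|P. (MIN c\<in>A. (thirds t x - c)\<^sup>2)) \<le> (LINT x|P. (1 / 3 ^ length t * x + (- (1/2) / 3 ^ length t))\<^sup>2)"
  proof (rule integral_continuous_mono)
    have "A \<noteq> {}" using assms by auto
    show "continuous_on UNIV (\<lambda>x. MIN c\<in>A. (thirds t x - c)\<^sup>2)"
      by (rule continuous_on_compose2[OF continuous_on_Min_squares continuous_on_thirds])
         (use assms \<open>A \<noteq> {}\<close> in auto)
    fix x
    have "(MIN c\<in>A. (thirds t x - c)\<^sup>2) \<le> (thirds t x - mid t)\<^sup>2"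
      using assms by (intro Min_le) auto
    also have "thirds t x - mid t = 1 / 3 ^ length t * x + (- (1/2) / 3 ^ length t)"
      by (simp add: thirds_affine diff_divide_distrib)
    finally show "(MIN c\<in>A. (thirds t x - c)\<^sup>2) \<le> (1 / 3 ^ length t * x + (- (1/2) / 3 ^ length t))\<^sup>2" .
  qed (intro continuous_intros)
  also have "\<dots> = (1 / 3 ^ length t)\<^sup>2 / 8"
    unfolding integral_square by simp
  also have "((3::real) ^ length t)\<^sup>2 = 9 ^ length t"
    by (simp add: power2_eq_square flip: power_mult_distrib)
  hence "(1 / (3::real) ^ length t)\<^sup>2 / 8 = 1 / (8 * 9 ^ length t)" by (simp add: power_divide)
  finally show ?thesis .
qed

end

text \<open>
  The binary words of the cells whose midpoints form \<open>alpha_n P l I\<close>, if \<open>I\<close> is the set of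
  midpoints of \<open>T\<close>.
\<close>

definition refine :: "nat \<Rightarrow> bool list set \<Rightarrow> bool list set" where
  "refine l T = ({t. length t = l} - T) \<union> {t @ [b] | t b. t \<in> T}"

lemma finite_refine: "finite T \<Longrightarrow> finite (refine l T)"
  and card_refine_le: "T \<subseteq> {t. length t = l} \<Longrightarrow> card (refine l T) \<le> 2 ^ l + card T"
proof -
  have eq: "{t @ [b] | t b. t \<in> T} = (\<lambda>(t, b). t @ [b]) ` (T \<times> UNIV)" by auto
  show "finite (refine l T)" if "finite T"
    unfolding refine_def eq using that finite_lists_length
    by (intro finite_UnI finite_Diff finite_imageI finite_cartesian_product) auto
  assume T: "T \<subseteq> {t. length t = l}"
  hence fin: "finite T" using finite_lists_length finite_subset by blast
  have "card (refine l T) \<le> card ({t. length t = l} - T) + card ((\<lambda>(t, b). t @ [b]) ` (T \<times> UNIV))"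
    unfolding refine_def eq by (rule card_Un_le)
  also have "card ((\<lambda>(t, b). t @ [b]) ` (T \<times> (UNIV :: bool set))) \<le> card (T \<times> (UNIV :: bool set))"
    using fin by (intro card_image_le) auto
  also have "card ({t. length t = l} - T) + card (T \<times> (UNIV :: bool set)) = 2 ^ l + card T"
    using card_mono[OF finite_lists_length T] T fin
    by (simp add: card_Diff_subset card_cartesian_product card_lists_length)
  finally show "card (refine l T) \<le> 2 ^ l + card T" by simp
qed

text \<open>
  Each of the \<open>2 ^ l\<close> cells carries the same mass.  With its own midpoint a cell costs \<open>1 / (8 * 9 ^ l)\<close>
  relative to its mass, and a ninth of that with the midpoints of its two subcells.  Here the
  chord is attained.
\<close>

lemma (in cantor_law) distortion_refine_le:
  assumes T: "T \<subseteq> {t. length t = l}"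
  shows "distortion P (mid ` refine l T) \<le> chord (Suc l) (2 ^ l + card T)"
proof -
  let ?A = "mid ` refine l T" and ?L = "{t :: bool list. length t = l}"
  let ?m = "\<lambda>x. MIN c\<in>?A. (x - c)\<^sup>2"
  have finT: "finite T" using T finite_lists_length finite_subset by blast
  have A: "finite ?A" using finite_refine[OF finT] by simp
  have "?L \<noteq> {}" using card_lists_length[of l] by (metis card.empty power_not_zero zero_neq_numeral)
  hence "refine l T \<noteq> {}" using T by (auto simp: refine_def)
  hence ne: "?A \<noteq> {}" by simp
  note cont = continuous_on_Min_squares[OF A ne]
  have old: "(LINT x|P. ?m (thirds t x)) \<le> 1 / (8 * 9 ^ l)" if "t \<in> ?L - T" for t
  proof -
    have "mid t \<in> ?A" using that by (auto simp: refine_def)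
    from cell_distortion_le[OF A this] that show ?thesis by simp
  qed
  have new: "(LINT x|P. ?m (thirds t x)) \<le> 1 / (72 * 9 ^ l)" if t: "t \<in> T" for t
  proof -
    have "(LINT x|P. ?m (thirds t (third b x))) \<le> 1 / (72 * 9 ^ l)" for b
    proof -
      have "mid (t @ [b]) \<in> ?A" using t by (auto simp: refine_def)
      from cell_distortion_le[OF A this] t T show ?thesis by (auto simp: subset_iff)
    qed
    from this[of False] this[of True] show ?thesis
      using integral_halves[OF integrable_continuous[OF continuous_on_compose2[OF cont continuous_on_thirds]], of t]
      by simp
  qed
  have "distortion P ?A = (\<Sum>t\<in>?L. LINT x|P. ?m (thirds t x)) / 2 ^ l"
    unfolding distortion_def by (rule integral_thirds_sum[OF cont])
  also have "(\<Sum>t\<in>?L. LINT x|P. ?m (thirds t x))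
      = (\<Sum>t\<in>?L - T. LINT x|P. ?m (thirds t x)) + (\<Sum>t\<in>T. LINT x|P. ?m (thirds t x))"
    by (rule sum.subset_diff[OF T finite_lists_length])
  also have "\<dots> \<le> card (?L - T) * (1 / (8 * 9 ^ l)) + card T * (1 / (72 * 9 ^ l))"
    by (intro add_mono sum_bounded_above old new) auto
  also have "real (card (?L - T)) = 2 ^ l - real (card T)"
    using card_mono[OF finite_lists_length T] finT T
    by (simp add: card_Diff_subset card_lists_length of_nat_diff)
  finally have "distortion P ?A \<le> ((2 ^ l - real (card T)) * (1 / (8 * 9 ^ l)) + card T * (1 / (72 * 9 ^ l))) / 2 ^ l"
    by (simp add: divide_right_mono)
  also have "\<dots> = chord (Suc l) (2 ^ l + card T)"
  proof -
    have "(18::real) ^ l = 2 ^ l * 9 ^ l" by (simp flip: power_mult_distrib)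
    thus ?thesis by (simp add: chord_def field_simps)
  qed
  finally show ?thesis .
qed

section \<open>Conditional means\<close>

lemma image_third_eq: "third b ` D = unthird b -` D"
proof -
  have inv: "unthird b (third b x) = x" "third b (unthird b y) = y" for x y
    by (simp_all add: third_def unthird_def add_divide_distrib)
  show ?thesis
  proof (intro equalityI subsetI)
    fix y assume "y \<in> unthird b -` D"
    thus "y \<in> third b ` D" by (intro image_eqI[of _ _ "unthird b y"]) (simp_all add: inv)
  qed (auto simp: inv)
qed

lemma unthird_measurable [measurable]: "unthird b \<in> borel_measurable borel"
  unfolding unthird_def by measurable

lemma borel_image_thirds: "C \<in> sets borel \<Longrightarrow> thirds t ` C \<in> sets borel"
proof (induction t)
  case (Cons b t)
  have "thirds (b # t) ` C = unthird b -` (thirds t ` C)"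
    by (simp add: image_third_eq[symmetric] image_image)
  thus ?case using measurable_sets[OF unthird_measurable Cons.IH[OF Cons.prems], of b] by simp
qed simp

context cantor_law
begin

text \<open>
  The images of \<open>[0, 1]\<close> under \<open>third False\<close> and \<open>third True\<close> are disjoint, so only one term of
  \<open>integral_halves\<close> survives at each letter.
\<close>

lemma set_integral_thirds:
  fixes f :: "real \<Rightarrow> real"
  assumes C: "C \<in> sets borel" "C \<subseteq> {0..1}" and f: "continuous_on UNIV f"
  shows "(LINT x:thirds t ` C|P. f x) = (LINT x:C|P. f (thirds t x)) / 2 ^ length t"
  using f
proof (induction t arbitrary: f)
  case (Cons b t)
  define D where "D = thirds t ` C"
  have D: "D \<in> sets borel" "D \<subseteq> {0..1}"
    using borel_image_thirds[OF C(1)] thirds_mem C(2) unfolding D_def by blast+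
  have E: "third b ` D \<in> sets borel" using measurable_sets[OF unthird_measurable D(1), of b]
    by (simp add: image_third_eq)
  let ?g = "\<lambda>x. indicator (third b ` D) x * f x"
  have "integrable P ?g"
    using integrable_mult_indicator[OF _ integrable_continuous[OF Cons.prems], of "third b ` D"] E
    by (simp add: sets_P)
  note halves = integral_halves[OF this]
  have same: "?g (third b x) = indicator D x * f (third b x)" for x
    by (auto simp: indicator_def third_def image_iff)
  have other: "(LINT x|P. ?g (third (\<not> b) x)) = 0"
  proof -
    have "AE x in P. ?g (third (\<not> b) x) = 0"
      using AE_unit
    proof eventually_elim
      case (elim x)
      have "third (\<not> b) x \<noteq> third b y" if "y \<in> D" for y
        using subsetD[OF D(2) that] elim by (cases b) (auto simp: third_def)
      hence "third (\<not> b) x \<notin> third b ` D" by blast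
      thus ?case by simp
    qed
    thus ?thesis by (rule integral_eq_zero_AE)
  qed
  have c: "continuous_on UNIV (\<lambda>x. f (third b x))"
    by (rule continuous_on_compose2[OF Cons.prems]) (auto simp: third_def intro!: continuous_intros)
  have "(LINT x:thirds (b # t) ` C|P. f x) = (LINT x|P. ?g x)"
    by (simp add: set_lebesgue_integral_def D_def image_image)
  also have "\<dots> = (LINT x|P. ?g (third b x)) / 2"
    using halves other by (cases b) simp_all
  also have "(LINT x|P. ?g (third b x)) = (LINT x:D|P. f (third b x))"
    by (simp add: same set_lebesgue_integral_def)
  also have "\<dots> = (LINT x:C|P. f (third b (thirds t x))) / 2 ^ length t"
    unfolding D_def by (rule Cons.IH[OF c])
  finally show ?case by simp
qed (simp add: set_lebesgue_integral_def)

text \<open>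
  A set of full measure is allowed in place of \<open>[0, 1]\<close> because \<open>cell_inf\<close> is the image of a union
  of cells that leaves out the gaps.
\<close>

lemma cond_mean_thirds:
  assumes C: "C \<in> sets borel" "C \<subseteq> {0..1}" "measure P C = 1"
  shows "cond_mean P (thirds t ` C) = mid t"
proof -
  have ae: "AE x in P. x \<in> C" using C prob_eq_1[of C] by (simp add: sets_P)
  have full: "(LINT x:C|P. f x) = (LINT x|P. f x)" if "continuous_on UNIV f" for f :: "real \<Rightarrow> real"
    unfolding set_lebesgue_integral_def
  proof (rule integral_cong_AE)
    show "f \<in> borel_measurable P"
      using borel_measurable_integrable[OF integrable_continuous[OF that]] .
    thus "(\<lambda>x. indicator C x *\<^sub>R f x) \<in> borel_measurable P" using C(1) by (simp add: sets_P)
    show "AE x in P. indicator C x *\<^sub>R f x = f x" using ae by eventually_elim simp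
  qed
  have "(LINT x:thirds t ` C|P. 1) = (1 / 2 ^ length t :: real)"
    using set_integral_thirds[OF C(1,2), of "\<lambda>_. 1" t] full[of "\<lambda>_. 1"] prob_space by simp
  hence m: "measure P (thirds t ` C) = 1 / 2 ^ length t"
    by (simp add: set_lebesgue_integral_def)
  have "(LINT x|P. thirds t x) = (LINT x|P. 0 * x\<^sup>2 + 1 / 3 ^ length t * x + (mid t - 1/2 / 3 ^ length t))"
    by (simp add: thirds_affine diff_divide_distrib algebra_simps)
  also have "\<dots> = mid t" unfolding integral_quadratic by simp
  finally have "(LINT x:thirds t ` C|P. x) = mid t / 2 ^ length t"
    using set_integral_thirds[OF C(1,2) continuous_on_id, of t] full[OF continuous_on_thirds] by simp
  thus ?thesis by (simp add: cond_mean_def m)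
qed

end

section \<open>Binary coding of words\<close>

text \<open>
  The letter \<open>j\<close> stands for \<open>T\<^sub>1\<close> iterated \<open>j - 1\<close> times after \<open>T\<^sub>0\<close>.
\<close>

definition bits :: "nat list \<Rightarrow> bool list" where
  "bits w = concat (map (\<lambda>j. replicate (j - 1) True @ [False]) w)"

text \<open>
  The cells of \<open>bump w j\<close> for \<open>j \<ge> 1\<close> all lie in the binary cell next to that of \<open>w\<close>, obtained by
  turning the final 0 into 1.
\<close>

definition next_bits :: "nat list \<Rightarrow> bool list" where
  "next_bits w = butlast (bits w) @ [True]"

lemma bits_Nil [simp]: "bits [] = []"
  and bits_Cons: "bits (j # w) = replicate (j - 1) True @ False # bits w"
  and bits_append [simp]: "bits (v @ w) = bits v @ bits w"
  by (simp_all add: bits_def)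

lemma sim_eq_thirds: "1 \<le> j \<Longrightarrow> sim j x = thirds (bits [j]) x"
proof (induction j rule: dec_induct)
  case base
  show ?case by (simp add: bits_Cons sim_def third_def)
next
  case (step j)
  have "sim (Suc j) x = third True (sim j x)"
    using step(1) by (cases j) (auto simp: third_def sim_def field_simps)
  moreover have "bits [Suc j] = True # bits [j]" using step(1) by (cases j) (auto simp: bits_Cons)
  ultimately show ?case using step by simp
qed

lemma sim_word_eq_thirds: "w \<in> words \<Longrightarrow> sim_word w = thirds (bits w)"
proof (induction w)
  case (Cons j w)
  hence "sim_word (j # w) x = thirds (bits [j]) (thirds (bits w) x)" for x
    using sim_eq_thirds[of j] by (auto simp: words_def sim_word_def)
  moreover have "bits (j # w) = bits [j] @ bits w" by (simp add: bits_Cons)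
  ultimately show ?case by (simp add: fun_eq_iff)
qed (auto simp: sim_word_def thirds_def)

lemma prob_word_eq: "w \<in> words \<Longrightarrow> prob_word w = 1 / 2 ^ length (bits w)"
proof (induction w)
  case (Cons j w)
  hence "j \<ge> 1" "prob_word w = 1 / 2 ^ length (bits w)" by (auto simp: words_def)
  thus ?case by (cases j) (simp_all add: prob_word_def bits_Cons power_add)
qed (simp add: prob_word_def)

lemma bits_snoc: "bits (w @ [j]) = (bits w @ replicate (j - 1) True) @ [False]"
  by (simp add: bits_Cons)

lemma next_bits_snoc: "1 \<le> j \<Longrightarrow> next_bits (w @ [j]) = bits w @ replicate j True"
  unfolding next_bits_def bits_snoc butlast_snoc
  by (cases j) (simp_all flip: replicate_append_same)

lemma length_next_bits: "w \<noteq> [] \<Longrightarrow> length (next_bits w) = length (bits w)"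
  by (cases w) (auto simp: next_bits_def bits_Cons)

lemma words_snocE:
  assumes "w \<in> words" "w \<noteq> []"
  obtains v j where "w = v @ [j]" "v \<in> words" "1 \<le> j"
  using assms by (cases w rule: rev_cases) (auto simp: words_def)

lemma bits_bump:
  assumes "w \<in> words" "w \<noteq> []" "1 \<le> j"
  shows "bits (bump w j) = next_bits w @ bits [j]"
  using assms(1,2)
proof (rule words_snocE)
  fix v i assume w: "w = v @ [i]" "1 \<le> i"
  have "replicate (i + j - 1) True = replicate i True @ replicate (j - 1) True"
    using assms(3) by (simp flip: replicate_add)
  thus ?thesis unfolding w(1) next_bits_snoc[OF w(2)]
    by (simp add: bump_def bits_Cons)
qed

lemma bump_ne_Nil: "bump w j \<noteq> []"
  by (simp add: bump_def)

lemma bump_words: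
  assumes "w \<in> words" "w \<noteq> []"
  shows "bump w j \<in> words"
  using assms by (rule words_snocE) (auto simp: bump_def words_def)

lemma next_bits_bump:
  assumes "w \<in> words" "w \<noteq> []"
  shows "next_bits (bump w 1) = next_bits w @ [True]"
  unfolding next_bits_def[of "bump w 1"] bits_bump[OF assms order_refl]
  by (simp add: bits_Cons butlast_append)

text \<open>
  Together with \<open>ex_next_bits\<close> this shows that cells of words and of their younger siblings exhaust all
  binary cells, according to the last digit.
\<close>

lemma ex_bits:
  assumes "t = [] \<or> \<not> last t"
  shows "\<exists>w\<in>words. bits w = t"
  using assms
proof (induction t)
  case Nil
  show ?case by (rule bexI[of _ "[]"]) (auto simp: words_def)
next
  case (Cons b t)
  have "t = [] \<or> \<not> last t" using Cons.prems by (cases t) auto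
  then obtain w where w: "w \<in> words" "bits w = t" using Cons.IH by blast
  show ?case
  proof (cases b)
    case False
    have "1 # w \<in> words" using w by (auto simp: words_def)
    moreover have "bits (1 # w) = b # t" using w False by (simp add: bits_Cons)
    ultimately show ?thesis by blast
  next
    case True
    hence "t \<noteq> []" using Cons.prems by auto
    then obtain j v where jv: "w = j # v" using w by (cases w) auto
    hence "Suc j # v \<in> words" "j \<ge> 1" using w by (auto simp: words_def)
    moreover have "bits (Suc j # v) = b # t"
      using w jv True \<open>j \<ge> 1\<close> by (cases j) (auto simp: bits_Cons)
    ultimately show ?thesis by blast
  qed
qed

lemma ex_next_bits:
  assumes "t \<noteq> []" "last t"
  shows "\<exists>w\<in>words. w \<noteq> [] \<and> next_bits w = t"
proof -
  obtain w where w: "w \<in> words" "bits w = butlast t @ [False]"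
    using ex_bits[of "butlast t @ [False]"] by auto
  have "next_bits w = butlast t @ [last t]" using assms(2) by (simp add: next_bits_def w)
  hence "next_bits w = t" unfolding append_butlast_last_id[OF assms(1)] .
  moreover have "w \<noteq> []" using w by auto
  ultimately show ?thesis using w by blast
qed

section \<open>Centers of words\<close>

context cantor_law
begin

lemma measure_unit: "measure P {0..1} = 1"
  using AE_unit by (subst prob_eq_1) (simp_all only: sets_P, simp_all)

lemma center_eq_mid: "w \<in> words \<Longrightarrow> center P w = mid (bits w)"
  unfolding center_def cell_def
  by (simp add: sim_word_eq_thirds cond_mean_thirds measure_unit)

text \<open>
  The union contains \<open>third False\<close> of \<open>[0, 1]\<close> and is mapped into itself by \<open>third True\<close>, so its mass
  \<open>q\<close> satisfies \<open>q \<ge> 1/2 + q/2\<close>.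
\<close>

lemma measure_cells: "measure P (\<Union>j\<in>{1..}. thirds (bits [j]) ` {0..1}) = 1"
proof -
  let ?U = "\<Union>j\<in>{1..}. thirds (bits [j]) ` {0..1}"
  have U: "?U \<in> sets borel" by (intro sets.countable_UN'' borel_image_thirds) auto
  have s: "third b -` ?U \<in> sets P" for b
    using measurable_sets[OF third_measurable U, of b] by (simp add: sets_P)
  have "{0..1} \<subseteq> third False -` ?U"
  proof
    fix x :: real assume "x \<in> {0..1}"
    hence "third False x \<in> thirds (bits [1]) ` {0..1}" by (auto simp: bits_Cons)
    thus "x \<in> third False -` ?U" by auto
  qed
  hence "1 \<le> measure P (third False -` ?U)" using finite_measure_mono[OF _ s] measure_unit by metis
  moreover have "?U \<subseteq> third True -` ?U"
  proof
    fix y assume "y \<in> ?U"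
    then obtain j x where j: "1 \<le> j" and x: "x \<in> {0..1}" "y = thirds (bits [j]) x" by auto
    have "bits [Suc j] = True # bits [j]" using j by (cases j) (auto simp: bits_Cons)
    hence "third True y \<in> thirds (bits [Suc j]) ` {0..1}" using x by auto
    thus "y \<in> third True -` ?U" by (auto intro!: bexI[of _ "Suc j"])
  qed
  hence "measure P ?U \<le> measure P (third True -` ?U)" by (rule finite_measure_mono[OF _ s])
  ultimately have "1 \<le> measure P ?U" using halves[OF U] by argo
  thus ?thesis using prob_le_1[of ?U] by argo
qed

lemma center_inf_eq_mid:
  assumes "w \<in> words" "w \<noteq> []"
  shows "center_inf P w = mid (next_bits w)"
proof -
  let ?U = "\<Union>j\<in>{1..}. thirds (bits [j]) ` {0..1}"
  have "cell (bump w j) = thirds (next_bits w) ` thirds (bits [j]) ` {0..1}" if "j \<in> {1..}" for j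
    using that assms by (simp add: cell_def sim_word_eq_thirds bump_words bits_bump image_image)
  hence "cell_inf w = thirds (next_bits w) ` ?U"
    by (simp add: cell_inf_def image_UN)
  moreover have "cond_mean P (thirds (next_bits w) ` ?U) = mid (next_bits w)"
  proof (rule cond_mean_thirds)
    show "?U \<in> sets borel" by (intro sets.countable_UN'' borel_image_thirds) auto
    show "?U \<subseteq> {0..1}" using thirds_mem by blast
  qed (rule measure_cells)
  ultimately show ?thesis by (simp add: center_inf_def)
qed

lemma alpha_eq:
  assumes "1 \<le> l"
  shows "alpha P l = mid ` {t. length t = l}"
proof -
  have "alpha P l = {mid (bits w) | w. w \<in> words \<and> length (bits w) = l} \<union>
      {mid (next_bits w) | w. w \<in> words \<and> w \<noteq> [] \<and> length (next_bits w) = l}"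
    unfolding alpha_def
    by (intro arg_cong2[of _ _ _ _ "(\<union>)"] Collect_cong ex_cong1)
       (auto simp: prob_word_eq center_eq_mid center_inf_eq_mid length_next_bits)
  also have "\<dots> = mid ` {t. length t = l}"
  proof (intro equalityI subsetI)
    fix y assume "y \<in> mid ` {t. length t = l}"
    then obtain t where t: "length t = l" "y = mid t" by auto
    show "y \<in> {mid (bits w) | w. w \<in> words \<and> length (bits w) = l} \<union>
      {mid (next_bits w) | w. w \<in> words \<and> w \<noteq> [] \<and> length (next_bits w) = l}"
    proof (cases "last t")
      case True
      have "t \<noteq> []" using t assms by auto
      from ex_next_bits[OF this True] show ?thesis using t by blast
    next
      case False
      with ex_bits[of t] show ?thesis using t by blast
    qed
  qed auto
  finally show ?thesis .
qed

lemma alpha_n_eq: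
  assumes l: "1 \<le> l" and T: "T \<subseteq> {t. length t = l}"
  shows "alpha_n P l (mid ` T) = mid ` refine l T"
proof -
  have I: "mid t \<in> mid ` T \<longleftrightarrow> t \<in> T" for t using inj_mid by (auto dest: injD)
  have w1: "w @ [1] \<in> words \<longleftrightarrow> w \<in> words" for w by (auto simp: words_def)
  have "center P (w @ [1]) = mid (bits w @ [False])"
    "center_inf P (w @ [1]) = mid (bits w @ [True])" if "w \<in> words" for w
    using that by (simp_all add: center_eq_mid center_inf_eq_mid w1 next_bits_snoc bits_Cons
        del: One_nat_def) (simp_all add: next_bits_snoc bits_Cons center_inf_eq_mid)
  note zero_children = this
  have one_children: "center P (bump w 1) = mid (next_bits w @ [False])"
    "center_inf P (bump w 1) = mid (next_bits w @ [True])" if "w \<in> words" "w \<noteq> []" for w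
    using that center_eq_mid[OF bump_words[OF that, of 1]]
      center_inf_eq_mid[OF bump_words[OF that, of 1] bump_ne_Nil]
      bits_bump[OF that order_refl] next_bits_bump[OF that] by (simp_all add: bits_Cons)
  have "alpha_n P l (mid ` T) = (mid ` {t. length t = l} - mid ` T) \<union>
      {mid (bits w @ [b]) | w b. w \<in> words \<and> bits w \<in> T} \<union>
      {mid (next_bits w @ [b]) | w b. w \<in> words \<and> w \<noteq> [] \<and> next_bits w \<in> T}"
  proof -
    have c: "w \<in> words \<and> center P w \<in> mid ` T \<longleftrightarrow> w \<in> words \<and> bits w \<in> T" for w
      using I center_eq_mid by metis
    have d: "w \<in> words \<and> w \<noteq> [] \<and> center_inf P w \<in> mid ` T
        \<longleftrightarrow> w \<in> words \<and> w \<noteq> [] \<and> next_bits w \<in> T" for w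
      using I center_inf_eq_mid by metis
    have "{center P (w @ [1]) | w. w \<in> words \<and> bits w \<in> T} \<union>
        {center_inf P (w @ [1]) | w. w \<in> words \<and> bits w \<in> T}
        = {mid (bits w @ [b]) | w b. w \<in> words \<and> bits w \<in> T}" (is "?l1 = ?r1")
    proof (intro equalityI subsetI)
      fix y assume "y \<in> ?r1"
      then obtain w b where w: "w \<in> words" "bits w \<in> T" and "y = mid (bits w @ [b])" by blast
      with w have "y = center P (w @ [1]) \<or> y = center_inf P (w @ [1])" using zero_children[of w] by (cases b) simp_all
      thus "y \<in> ?l1" using w by blast
    qed (use zero_children in blast)
    moreover have "{center P (bump w 1) | w. w \<in> words \<and> w \<noteq> [] \<and> next_bits w \<in> T} \<union>
        {center_inf P (bump w 1) | w. w \<in> words \<and> w \<noteq> [] \<and> next_bits w \<in> T}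
        = {mid (next_bits w @ [b]) | w b. w \<in> words \<and> w \<noteq> [] \<and> next_bits w \<in> T}" (is "?l2 = ?r2")
    proof (intro equalityI subsetI)
      fix y assume "y \<in> ?r2"
      then obtain w b where w: "w \<in> words" "w \<noteq> []" "next_bits w \<in> T" and "y = mid (next_bits w @ [b])" by blast
      with w have "y = center P (bump w 1) \<or> y = center_inf P (bump w 1)" using one_children[of w] by (cases b) simp_all
      thus "y \<in> ?l2" using w by blast
    qed (use one_children in blast)
    ultimately show ?thesis
      unfolding alpha_n_def alpha_eq[OF l] c d by (simp only: Un_assoc)
  qed
  also have "\<dots> = mid ` refine l T"
  proof -
    have "mid ` {t. length t = l} - mid ` T = mid ` ({t. length t = l} - T)"
      by (simp add: image_set_diff[OF inj_mid])
    moreover have "{mid (bits w @ [b]) | w b. w \<in> words \<and> bits w \<in> T} \<union>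
      {mid (next_bits w @ [b]) | w b. w \<in> words \<and> w \<noteq> [] \<and> next_bits w \<in> T} = mid ` {t @ [b] | t b. t \<in> T}"
      (is "?l = ?r")
    proof (intro equalityI subsetI)
      fix y assume "y \<in> ?r"
      then obtain t b where t: "t \<in> T" "y = mid (t @ [b])" by blast
      show "y \<in> ?l"
      proof (cases "t = [] \<or> \<not> last t")
        case True
        with ex_bits[OF this] t show ?thesis by blast
      next
        case False
        with ex_next_bits[of t] t show ?thesis by blast
      qed
    qed blast
    ultimately show ?thesis by (simp only: refine_def image_Un Un_assoc)
  qed
  finally show ?thesis .
qed

text \<open>
  New midpoints belong to longer binary words and are therefore never in \<open>alpha P l\<close>; hence \<open>I\<close> is
  exactly what \<open>alpha_n P l I\<close> misses of \<open>alpha P l\<close>.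
\<close>

lemma inj_on_alpha_n:
  assumes l: "1 \<le> l"
  shows "inj_on (alpha_n P l) (Pow (alpha P l))"
proof (rule inj_onI)
  have rec: "I = alpha P l - alpha_n P l I" if sub: "I \<in> Pow (alpha P l)" for I
  proof -
    from sub obtain T where T: "T \<subseteq> {t. length t = l}" "I = mid ` T"
      unfolding alpha_eq[OF l] by (auto simp: subset_image_iff)
    have "length (t @ [b]) = Suc l" if "t \<in> T" for t b using T(1) that by auto
    hence "{t. length t = l} - refine l T = T" using T(1) by (force simp: refine_def)
    thus ?thesis
      unfolding T(2) alpha_n_eq[OF l T(1)] alpha_eq[OF l] by (metis image_set_diff[OF inj_mid])
  qed
  fix I J assume "I \<in> Pow (alpha P l)" "J \<in> Pow (alpha P l)" "alpha_n P l I = alpha_n P l J"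
  thus "I = J" using rec by metis
qed

end

section \<open>Optimal sets of n-means\<close>

theorem theorem3p15:
  fixes P :: "real measure" and n l :: nat
  assumes "self_similar_measure P"
    and "n \<ge> 2"
    and "l \<ge> 1" and "2 ^ l \<le> n" and "n < 2 ^ (l + 1)"
  shows "(\<forall>I. I \<subseteq> alpha P l \<and> card I = n - 2 ^ l \<longrightarrow> optimal_means P n (alpha_n P l I)) \<and>
    quantization_error P n =
      1 / 18 ^ l * (1 / 8) * (2 ^ (l + 1) - real n + 1 / 9 * (real n - 2 ^ l)) \<and>
    card {alpha_n P l I | I. I \<subseteq> alpha P l \<and> card I = n - 2 ^ l} = 2 ^ l choose (n - 2 ^ l)"
proof -
  interpret cantor_law P using assms(1) by (rule self_similar_imp_cantor_law)
  let ?v = "chord (Suc l) n"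
  have card_alpha: "finite (alpha P l)" "card (alpha P l) = 2 ^ l"
    using inj_mid finite_lists_length[of l] card_lists_length[of l]
    by (simp_all add: alpha_eq[OF assms(3)] card_image inj_on_subset[OF inj_mid])
  have lower: "?v \<le> distortion P A" if "1 \<le> card A" "card A \<le> n" for A
  proof -
    have "finite A" "A \<noteq> {}" using that by (auto intro: card_ge_0_finite)
    thus ?thesis using chord_le_distortion[of A "Suc l"] chord_antimono[OF that(2), of "Suc l"] by linarith
  qed
  have attained: "1 \<le> card (alpha_n P l I) \<and> card (alpha_n P l I) \<le> n \<and> distortion P (alpha_n P l I) = ?v"
    if I: "I \<subseteq> alpha P l" "card I = n - 2 ^ l" for I
  proof -
    from I(1) obtain T where T: "T \<subseteq> {t. length t = l}" "I = mid ` T"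
      unfolding alpha_eq[OF assms(3)] by (auto simp: subset_image_iff)
    have cT: "2 ^ l + card T = n"
      using I(2) assms(4) by (simp add: T(2) card_image inj_on_subset[OF inj_mid])
    have eq: "alpha_n P l I = mid ` refine l T" unfolding T(2) by (rule alpha_n_eq[OF assms(3) T(1)])
    have fin: "finite (refine l T)" using T(1) finite_lists_length finite_subset by (intro finite_refine) blast
    have "card (alpha_n P l I) \<le> n" unfolding eq
      using card_image_le[OF fin, of mid] card_refine_le[OF T(1)] cT by simp
    moreover have "refine l T \<noteq> {}"
    proof (cases "T = {}")
      case True
      have "replicate l True \<in> refine l T" using True by (simp add: refine_def)
      thus ?thesis by blast
    qed (auto simp: refine_def)
    hence "1 \<le> card (alpha_n P l I)" unfolding eq using fin by (simp add: Suc_le_eq card_gt_0_iff)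
    moreover have "distortion P (alpha_n P l I) \<le> ?v"
      using distortion_refine_le[OF T(1)] by (simp add: eq cT)
    ultimately show ?thesis using lower[of "alpha_n P l I"] by (intro conjI antisym)
  qed
  obtain I where I: "I \<subseteq> alpha P l" "card I = n - 2 ^ l"
  proof -
    have "n - 2 ^ l \<le> card (alpha P l)" using assms(5) by (simp add: card_alpha)
    thus thesis using that obtain_subset_with_card_n by metis
  qed
  have V: "quantization_error P n = ?v"
    unfolding quantization_error_def
  proof (rule cInf_eq_minimum)
    show "?v \<in> {distortion P A | A. 1 \<le> card A \<and> card A \<le> n}" using attained[OF I] by force
  qed (use lower in blast)
  have "{alpha_n P l I | I. I \<subseteq> alpha P l \<and> card I = n - 2 ^ l}
      = alpha_n P l ` {I. I \<subseteq> alpha P l \<and> card I = n - 2 ^ l}" by blast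
  also have "card \<dots> = card {I. I \<subseteq> alpha P l \<and> card I = n - 2 ^ l}"
    by (rule card_image, rule inj_on_subset[OF inj_on_alpha_n[OF assms(3)]]) auto
  also have "\<dots> = 2 ^ l choose (n - 2 ^ l)" using n_subsets[OF card_alpha(1)] by (simp add: card_alpha)
  finally have count: "card {alpha_n P l I | I. I \<subseteq> alpha P l \<and> card I = n - 2 ^ l} = \<dots>" .
  moreover have "?v = 1 / 18 ^ l * (1 / 8) * (2 ^ (l + 1) - real n + 1 / 9 * (real n - 2 ^ l))"
    by (simp add: chord_def field_simps)
  ultimately show ?thesis using attained V by (simp add: optimal_means_def)
qed

end
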